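(* Let $X$ be a real normed space of finite dimension $d$ and let $p=(p_v)_{v\in S}\in X^S$ be a placement of a set $S$ in $X$ such that the affine span of $\{p_v:v\in S\}$ has dimension $n$, where $1\le n\le d$. Then $$\dim\mathcal{T}(p)\le\frac{(n+1)(2d-n)}{2},$$ with equality if and only if $X$ is Euclidean.
   Context: A normed space is Euclidean if its norm is generated by an inner product. $\operatorname{Isom}(X)$ is the group of isometries of $X$. A placement of a set $S$ in $X$ is $p=(p_v)_{v\in S}\in X^S$. The orbit of $p$ is $\mathcal{O}_p=\{(g(p_v))_{v\in S}:g\in\operatorname{Isom}(X)\}$. A trivial finite motion of $p$ is a family $\alpha=(\alpha_v)_{v\in S}$ of continuous paths $\alpha_v:(-\delta,\delta)\to X$ (for some fixed $\delta>0$) with $\alpha_v(0)=p_v$ for all $v$ and $(\alpha_v(t))_{v\in S}\in\mathcal{O}_p$ for all $t\in(-\delta,\delta)$. $\mathcal{T}(p)$ is the set of trivial (infinitesimal) motions of $p$: those $u\in X^S$ for which there is a trivial finite motion $\alpha$ of $p$, differentiable at $t=0$, with $u_v=\alpha_v'(0)$ for all $v\in S$; it is a finite dimensional linear space. *)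

theory Defs
  imports "HOL-Analysis.Analysis" "HOL-Library.Function_Algebras"
begin

text \<open>
  Pointwise real vector space structure on functions. It gives the spaces \<open>X\<^sup>S\<close> below the
  library notion \<^const>\<open>dim\<close> without requiring \<open>S\<close> to be finite.
\<close>

instantiation "fun" :: (type, real_vector) real_vector
begin

definition scaleR_fun :: "real \<Rightarrow> ('a \<Rightarrow> 'b) \<Rightarrow> 'a \<Rightarrow> 'b"
  where "scaleR_fun c f = (\<lambda>v. c *\<^sub>R f v)"

instance
  by standard (simp_all add: scaleR_fun_def fun_eq_iff scaleR_add_right scaleR_add_left)

end

lemma scaleR_fun_apply [simp]: "(c *\<^sub>R f) v = c *\<^sub>R f v"
  by (simp add: scaleR_fun_def)

definition inner_product :: "('a::real_vector \<Rightarrow> 'a \<Rightarrow> real) \<Rightarrow> bool"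
  where "inner_product b \<longleftrightarrow>
    bilinear b \<and> (\<forall>x y. b x y = b y x) \<and> (\<forall>x. x \<noteq> 0 \<longrightarrow> b x x > 0)"

text \<open>
  A predicate on the given norm of the type, as opposed to the type class \<^class>\<open>real_inner\<close>.
\<close>

definition euclidean_norm :: "'a::real_normed_vector itself \<Rightarrow> bool"
  where "euclidean_norm _ \<longleftrightarrow>
    (\<exists>b :: 'a \<Rightarrow> 'a \<Rightarrow> real. inner_product b \<and> (\<forall>x. norm x = sqrt (b x x)))"

definition isometries :: "('a::metric_space \<Rightarrow> 'a) set"
  where "isometries = {g. bij g \<and> (\<forall>x y. dist (g x) (g y) = dist x y)}"

text \<open>
  The space \<open>X\<^sup>S\<close>: families indexed by \<open>S\<close> are represented by total functions that vanish
  outside \<open>S\<close>, so that equality and the vector space operations are those of \<open>X\<^sup>S\<close>.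
\<close>

definition families :: "'s set \<Rightarrow> ('s \<Rightarrow> 'a::zero) set"
  where "families S = {p. \<forall>v. v \<notin> S \<longrightarrow> p v = 0}"

definition orbit :: "'s set \<Rightarrow> ('s \<Rightarrow> 'a::real_normed_vector) \<Rightarrow> ('s \<Rightarrow> 'a) set"
  where "orbit S p = {q \<in> families S. \<exists>g \<in> isometries. \<forall>v\<in>S. q v = g (p v)}"

text \<open>
  The paths \<open>\<alpha> v\<close> are total functions, but only their values on \<open>{-\<delta><..<\<delta>}\<close> matter.
\<close>

definition trivial_finite_motion ::
    "'s set \<Rightarrow> ('s \<Rightarrow> 'a::real_normed_vector) \<Rightarrow> real \<Rightarrow> ('s \<Rightarrow> real \<Rightarrow> 'a) \<Rightarrow> bool"
  where "trivial_finite_motion S p \<delta> \<alpha> \<longleftrightarrow> \<delta> > 0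
    \<and> (\<forall>v\<in>S. continuous_on {-\<delta><..<\<delta>} (\<alpha> v) \<and> \<alpha> v 0 = p v)
    \<and> (\<forall>t\<in>{-\<delta><..<\<delta>}. (\<lambda>v. \<alpha> v t) \<in> orbit S p)"

definition trivial_motions ::
    "'s set \<Rightarrow> ('s \<Rightarrow> 'a::real_normed_vector) \<Rightarrow> ('s \<Rightarrow> 'a) set"
  where "trivial_motions S p = {u \<in> families S. \<exists>\<delta> \<alpha>. trivial_finite_motion S p \<delta> \<alpha>
    \<and> (\<forall>v\<in>S. (\<alpha> v has_vector_derivative u v) (at 0))}"

text \<open>
  Dimension of a nonempty affine subspace, as the dimension of its direction space; the library's
  \<^const>\<open>aff_dim\<close> is confined to the class \<^class>\<open>euclidean_space\<close>, whose norm is Euclidean.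
\<close>

definition affine_dimension :: "'a::real_vector set \<Rightarrow> nat"
  where "affine_dimension A = dim {x - y | x y. x \<in> A \<and> y \<in> A}"

end

theory Submission
  imports Defs
begin

text \<open>
  Fix a point \<open>p\<^sub>a\<close> of the placement and let \<open>W\<close>, of dimension \<open>n\<close>, be the direction space of its
  affine hull. Isometries of a normed space are affine (Mazur and Ulam, \<open>isometry_linear_part\<close>), so a
  trivial finite motion is described by the path of \<open>p\<^sub>a\<close> and a family \<open>A\<^sub>t\<close> of linear isometries of
  which only the restrictions to \<open>W\<close> need to depend continuously on \<open>t\<close>.

  \<^emph>\<open>Upper bound.\<close> There is an inner product \<open>b\<close>, whose norm in general differs from the given one, that is
  invariant under all linear isometries (\<open>invariant_inner_product_exists\<close>). Differentiating \<open>b (A\<^sub>t x) (A\<^sub>t y) = b x y\<close> at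
  \<open>t = 0\<close> shows that a trivial motion has the form \<open>v \<mapsto> u\<^sub>a + L (p\<^sub>v - p\<^sub>a)\<close> with \<open>L : W \<rightarrow> X\<close> skew for
  \<open>b\<close> (\<open>trivial_motions_rigid\<close>). In an orthonormal frame \<open>e\<^sub>0, ..., e\<^sub>d\<^sub>-\<^sub>1\<close> whose first \<open>n\<close> members span
  \<open>W\<close>, such a motion is a combination of \<open>d\<close> translations and of one infinitesimal rotation for each
  pair \<open>j < i\<close> with \<open>j < n\<close> and \<open>i < d\<close>, and there are \<open>(n + 1) (2 d - n) / 2\<close> of these basic motions.

  \<^emph>\<open>Euclidean spaces.\<close> When \<open>b\<close> generates the norm, translations and plane rotations are isometries, so
  every basic motion is a trivial motion and the bound is attained (\<open>euclidean_basic_motion_trivial\<close>).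

  \<^emph>\<open>Equality.\<close> If the bound is attained, then the span of the trivial motions contains all the skew
  families above. Let \<open>w = p\<^sub>v - p\<^sub>a \<noteq> 0\<close>, and let \<open>z\<close> have the same \<open>b\<close>-length as \<open>w\<close>. Among all vectors that
  share both the norm and the \<open>b\<close>-length of \<open>z\<close>, let \<open>m\<close> maximise \<open>b m w\<close>. Linear isometries permute these
  vectors, so moving \<open>w\<close> by a trivial motion cannot increase \<open>b m w\<close>, and \<open>m\<close> is orthogonal to the
  velocity of \<open>w\<close> under every trivial motion, hence to all of \<open>w\<^sup>\<bottom>\<close>. So \<open>m\<close> is a multiple of \<open>w\<close>,
  and then \<open>m = w\<close>, which gives \<open>norm z = norm w\<close> (\<open>norm_constant_on_spheres\<close>). The norm is therefore a
  multiple of the norm of \<open>b\<close>.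
\<close>

section \<open>Linear algebra\<close>

lemma sum_fun_apply: "(\<Sum>i\<in>I. f i) v = (\<Sum>i\<in>I. f i v)"
  for f :: "'i \<Rightarrow> 's \<Rightarrow> 'a::comm_monoid_add"
  by (induction I rule: infinite_finite_induct) auto

text \<open>
  Indices rather than vectors carry the coefficients, so that injectivity of the family, which a count of
  its members needs, comes together with independence.
\<close>

lemma independent_familyI:
  fixes f :: "'i \<Rightarrow> 'v::real_vector"
  assumes fin: "finite J"
    and ind: "\<And>c j. (\<Sum>i\<in>J. c i *\<^sub>R f i) = 0 \<Longrightarrow> j \<in> J \<Longrightarrow> c j = 0"
  shows "inj_on f J" "independent (f ` J)"
proof -
  show inj: "inj_on f J"
  proof (rule inj_onI, rule ccontr)
    fix i j assume ij: "i \<in> J" "j \<in> J" "f i = f j" "i \<noteq> j"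
    define c :: "'i \<Rightarrow> real" where "c k = (if k = i then 1 else 0) - (if k = j then 1 else 0)" for k
    have "(\<Sum>k\<in>J. c k *\<^sub>R f k) =
        (\<Sum>k\<in>J. if k = i then f k else 0) - (\<Sum>k\<in>J. if k = j then f k else 0)"
      unfolding sum_subtractf[symmetric] by (intro sum.cong) (auto simp: c_def)
    then have "(\<Sum>k\<in>J. c k *\<^sub>R f k) = 0" using ij fin by simp
    then have "c i = 0" using ij(1) by (rule ind)
    then show False using ij(4) by (simp add: c_def)
  qed
  show "independent (f ` J)"
    unfolding dependent_finite[OF finite_imageI[OF fin]]
    using ind[of "\<lambda>i. u (f i)" for u] by (auto simp: sum.reindex[OF inj])
qed

text \<open>
  A vector of \<open>T\<close> outside \<open>span C\<close> would extend \<open>C\<close> to an independent set with more elements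
  than \<open>T\<close> inside \<open>span T\<close>.
\<close>

lemma span_subset_span_if_card_le:
  fixes C T :: "'v::real_vector set"
  assumes T: "finite T" and C: "independent C" "C \<subseteq> span T" "card T \<le> card C"
  shows "span T \<subseteq> span C"
proof -
  have "x \<in> span C" if x: "x \<in> T" for x
  proof (rule ccontr)
    assume "x \<notin> span C"
    then have ind: "independent (insert x C)" and new: "x \<notin> C"
      using C(1) span_base[of x C] by (auto simp: independent_insert)
    have "insert x C \<subseteq> span T"
      using C(2) span_base[OF x] by simp
    with ind have "finite (insert x C) \<and> card (insert x C) \<le> card T"
      by (rule independent_span_bound[OF T])
    then show False using C(3) new card_insert_disjoint[of C x] by auto
  qed
  then show ?thesis by (intro span_minimal) auto
qed

lemma span_differences_affine_hull:
  fixes P :: "'a::real_vector set"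
  assumes "a \<in> P"
  shows "span {x - y |x y. x \<in> affine hull P \<and> y \<in> affine hull P} = span ((\<lambda>x. x - a) ` P)"
proof (rule span_eq[THEN iffD2], intro conjI subsetI)
  fix z assume "z \<in> {x - y |x y. x \<in> affine hull P \<and> y \<in> affine hull P}"
  then obtain x y where z: "z = x - y" "x \<in> affine hull P" "y \<in> affine hull P" by blast
  have "x - a \<in> span ((\<lambda>x. x - a) ` P)" if "x \<in> affine hull P" for x
  proof -
    have "affine hull P = (\<lambda>x. a + x) ` span ((\<lambda>x. - a + x) ` P)"
      by (rule affine_hull_span_gen) (simp add: assms hull_inc)
    with that obtain s where "x = a + s" "s \<in> span ((\<lambda>x. - a + x) ` P)" by blast
    then show ?thesis by simp
  qed
  from span_diff[OF this[OF z(2)] this[OF z(3)]] show "z \<in> span ((\<lambda>x. x - a) ` P)"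
    by (simp add: z(1))
next
  fix z assume "z \<in> (\<lambda>x. x - a) ` P"
  then obtain x where x: "x \<in> P" "z = x - a" by blast
  have "x \<in> affine hull P" "a \<in> affine hull P"
    using x(1) assms by (simp_all add: hull_inc)
  then show "z \<in> span {x - y |x y. x \<in> affine hull P \<and> y \<in> affine hull P}"
    using x(2) by (intro span_base) blast
qed

lemma sum_representation_UNIV:
  fixes B :: "'a::real_vector set"
  assumes "independent B" "finite B" "span B = UNIV"
  shows "(\<Sum>w\<in>B. representation B x w *\<^sub>R w) = x"
  using assms sum_representation_eq[of B x B] by auto

section \<open>Finite-dimensional normed spaces\<close>

text \<open>
  Finite-dimensional spaces are parametrised by coordinate vectors, taken as total functions that vanish
  off \<open>B\<close>. Boxes of such functions are compact in the product topology by Tychonoff's theorem.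
\<close>

definition coordinate_box :: "'b set \<Rightarrow> real \<Rightarrow> ('b \<Rightarrow> real) set"
  where "coordinate_box B M = PiE UNIV (\<lambda>v. if v \<in> B then {-M..M} else {0})"

lemma compact_coordinate_box: "compact (coordinate_box B M)"
proof -
  have "compactin (product_topology (\<lambda>i. euclidean) UNIV) (coordinate_box B M)"
    unfolding coordinate_box_def by (subst compactin_PiE) auto
  then show ?thesis
    by (simp add: euclidean_product_topology)
qed

lemma continuous_on_linear_combination:
  fixes B :: "'a::real_normed_vector set"
  shows "continuous_on K (\<lambda>f. \<Sum>v\<in>B. f v *\<^sub>R v)"
  by (intro continuous_intros continuous_on_subset[OF continuous_on_product_coordinates subset_UNIV])

text \<open>
  Equivalence of the given norm and the \<open>l\<^sup>1\<close> norm of the coordinates: on the compact \<open>l\<^sup>1\<close> unit sphere the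
  continuous function \<open>norm\<close> attains its minimum, which is positive because \<open>B\<close> is independent.
\<close>

lemma coordinates_bounded:
  fixes B :: "'a::real_normed_vector set"
  assumes B: "independent B" "finite B" "span B = UNIV"
  obtains C where "C > 0" "\<And>x. (\<Sum>v\<in>B. \<bar>representation B x v\<bar>) \<le> C * norm x"
proof (cases "B = {}")
  case True
  then show ?thesis using that[of 1] by simp
next
  case False
  define P where "P = coordinate_box B 1 \<inter> {f. (\<Sum>v\<in>B. \<bar>f v\<bar>) = 1}"
  have cl: "closed {f :: 'a \<Rightarrow> real. (\<Sum>v\<in>B. \<bar>f v\<bar>) = 1}"
    by (intro closed_Collect_eq continuous_intros continuous_on_product_coordinates)
  have "compact P"
    unfolding P_def by (intro compact_Int_closed compact_coordinate_box cl)
  moreover obtain b where b: "b \<in> B" using False by blast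
  have "(\<lambda>v. if v = b then 1 else 0) \<in> P"
    using b B(2) by (auto simp: P_def coordinate_box_def if_distrib cong: if_cong)
  then have "P \<noteq> {}" by blast
  ultimately have "\<exists>f0\<in>P. \<forall>f\<in>P. norm (\<Sum>v\<in>B. f0 v *\<^sub>R v) \<le> norm (\<Sum>v\<in>B. f v *\<^sub>R v)"
    by (intro continuous_attains_inf continuous_on_norm continuous_on_linear_combination)
  then obtain f0 where f0: "f0 \<in> P"
    and min: "\<And>f. f \<in> P \<Longrightarrow> norm (\<Sum>v\<in>B. f0 v *\<^sub>R v) \<le> norm (\<Sum>v\<in>B. f v *\<^sub>R v)"
    by blast
  define m where "m = norm (\<Sum>v\<in>B. f0 v *\<^sub>R v)"
  have "m > 0"
  proof -
    have "\<exists>v\<in>B. f0 v \<noteq> 0"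
    proof (rule ccontr)
      assume "\<not> ?thesis"
      then have "(\<Sum>v\<in>B. \<bar>f0 v\<bar>) = 0" by simp
      with f0 show False by (simp add: P_def)
    qed
    then have "(\<Sum>v\<in>B. f0 v *\<^sub>R v) \<noteq> 0"
      using B(1,2) independentD[of B B f0] by blast
    then show ?thesis by (simp add: m_def)
  qed
  have bound: "m * (\<Sum>v\<in>B. \<bar>representation B x v\<bar>) \<le> norm x" for x
  proof (cases "(\<Sum>v\<in>B. \<bar>representation B x v\<bar>) = 0")
    case True
    then show ?thesis by simp
  next
    case False
    define s where "s = (\<Sum>v\<in>B. \<bar>representation B x v\<bar>)"
    have s: "s > 0" using False sum_nonneg[of B "\<lambda>v. \<bar>representation B x v\<bar>"]
      by (auto simp: s_def less_le)
    define f where "f v = (if v \<in> B then representation B x v / s else 0)" for v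
    have sumf: "(\<Sum>v\<in>B. \<bar>f v\<bar>) = 1"
    proof -
      have "(\<Sum>v\<in>B. \<bar>f v\<bar>) = (\<Sum>v\<in>B. \<bar>representation B x v\<bar> / s)"
        using s by (intro sum.cong) (auto simp: f_def)
      also have "\<dots> = s / s"
        unfolding sum_divide_distrib[symmetric] s_def ..
      finally show ?thesis using s by simp
    qed
    have "f v \<in> {-1..1}" if "v \<in> B" for v
      using member_le_sum[of v B "\<lambda>v. \<bar>f v\<bar>"] that B(2) sumf by (simp add: abs_le_iff)
    moreover have "f v = 0" if "v \<notin> B" for v
      using that by (simp add: f_def)
    ultimately have "f \<in> P"
      using sumf by (simp add: P_def coordinate_box_def PiE_UNIV_domain)
    then have "m \<le> norm (\<Sum>v\<in>B. f v *\<^sub>R v)"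
      using min by (simp add: m_def)
    also have "(\<Sum>v\<in>B. f v *\<^sub>R v) = (1/s) *\<^sub>R (\<Sum>v\<in>B. representation B x v *\<^sub>R v)"
      by (simp add: scaleR_sum_right f_def divide_inverse mult.commute cong: sum.cong)
    also have "\<dots> = (1/s) *\<^sub>R x"
      using sum_representation_UNIV[OF B] by simp
    finally show ?thesis
      using s by (simp add: s_def[symmetric] field_simps)
  qed
  have "(\<Sum>v\<in>B. \<bar>representation B x v\<bar>) \<le> (1/m) * norm x" for x
    using bound[of x] \<open>m > 0\<close> by (simp add: field_simps)
  then show ?thesis using that[of "1/m"] \<open>m > 0\<close> by simp
qed

text \<open>
  A bounded set has bounded coordinates, so it lies in the image of a compact coordinate box.
\<close>

lemma compact_if_closed_bounded:
  fixes K :: "'a::real_normed_vector set"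
  assumes B: "independent B" "finite B" "span B = (UNIV :: 'a set)"
    and K: "closed K" "bounded K"
  shows "compact K"
proof -
  obtain C where C: "C > 0" "\<And>x. (\<Sum>v\<in>B. \<bar>representation B x v\<bar>) \<le> C * norm x"
    using coordinates_bounded[OF B] by blast
  obtain R where R: "\<And>x. x \<in> K \<Longrightarrow> norm x \<le> R"
    using K(2) by (auto simp: bounded_iff)
  define I where "I = (\<lambda>f. \<Sum>v\<in>B. f v *\<^sub>R v) ` coordinate_box B (C * R)"
  have "compact I"
    unfolding I_def
    by (intro compact_continuous_image continuous_on_linear_combination compact_coordinate_box)
  moreover have "K \<subseteq> I"
  proof
    fix x assume x: "x \<in> K"
    define f where "f v = (if v \<in> B then representation B x v else 0)" for v
    have "\<bar>f v\<bar> \<le> C * R" if "v \<in> B" for v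
    proof -
      have "\<bar>f v\<bar> \<le> (\<Sum>v\<in>B. \<bar>representation B x v\<bar>)"
        using member_le_sum[of v B "\<lambda>v. \<bar>representation B x v\<bar>"] that B(2) by (simp add: f_def)
      also have "\<dots> \<le> C * norm x" by (rule C)
      also have "\<dots> \<le> C * R" using R[OF x] C(1) by simp
      finally show ?thesis .
    qed
    then have "f \<in> coordinate_box B (C * R)"
      by (auto simp: coordinate_box_def f_def abs_le_iff) (smt (verit))+
    moreover have "(\<Sum>v\<in>B. f v *\<^sub>R v) = x"
      using sum_representation_UNIV[OF B, of x] by (simp add: f_def cong: sum.cong)
    ultimately show "x \<in> I" unfolding I_def by blast
  qed
  ultimately show ?thesis
    using K(1) compact_Int_closed[of I K] by (simp add: Int_absorb1)
qed

section \<open>Isometries are affine\<close>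

lemma isometries_comp: "f \<in> isometries \<Longrightarrow> g \<in> isometries \<Longrightarrow> f \<circ> g \<in> isometries"
  by (auto simp: isometries_def intro: bij_comp)

lemma isometries_inv: "f \<in> isometries \<Longrightarrow> inv f \<in> isometries"
  by (auto simp: isometries_def bij_imp_bij_inv) (metis bij_inv_eq_iff)

lemma point_reflection_isometries:
  "(\<lambda>x. a - x :: 'a::real_normed_vector) \<in> isometries"
proof -
  have "bij (\<lambda>x. a - x :: 'a)"
    by (rule o_bij[of "\<lambda>x. a - x"]) (auto simp: fun_eq_iff)
  then show ?thesis
    by (auto simp: isometries_def dist_norm norm_minus_commute)
qed

text \<open>
  Vaisala's proof of the Mazur-Ulam theorem. Let \<open>\<psi>\<close> be the point reflection in the midpoint \<open>z\<close>. If an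
  isometry \<open>h\<close> fixes \<open>a\<close> and \<open>b\<close>, then so does \<open>\<psi> \<circ> h\<^sup>-\<^sup>1 \<circ> \<psi> \<circ> h\<close>, and this isometry moves \<open>z\<close> twice as
  far as \<open>h\<close> does. But no isometry fixing \<open>a\<close> moves \<open>z\<close> by more than \<open>2 dist a z\<close>.
\<close>

lemma isometry_fixes_midpoint:
  fixes a b :: "'a::real_normed_vector"
  assumes g: "g \<in> isometries" "g a = a" "g b = b"
  shows "g (midpoint a b) = midpoint a b"
proof -
  define z where "z = midpoint a b"
  define W where "W = {h \<in> isometries. h a = a \<and> h b = b}"
  define \<psi> where "\<psi> x = a + b - x" for x
  have \<psi>: "\<psi> \<in> isometries"
    using point_reflection_isometries[of "a + b"] by (simp add: \<psi>_def[abs_def])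
  have \<psi>z: "dist (\<psi> x) z = dist x z" "dist (\<psi> x) x = 2 * dist x z" for x
  proof -
    have z2: "a + b = 2 *\<^sub>R z" by (simp add: z_def midpoint_def)
    have "\<psi> x - z = z - x" unfolding \<psi>_def z2 by (simp add: scaleR_2)
    then show "dist (\<psi> x) z = dist x z" by (simp add: dist_norm norm_minus_commute)
    have "\<psi> x - x = 2 *\<^sub>R (z - x)" unfolding \<psi>_def z2 by (simp add: scaleR_2)
    then show "dist (\<psi> x) x = 2 * dist x z" by (simp add: dist_norm norm_minus_commute)
  qed
  have bdd: "dist (h z) z \<le> 2 * dist a z" if "h \<in> W" for h
  proof -
    have "dist (h z) z \<le> dist (h z) (h a) + dist a z"
      using that dist_triangle[of "h z" z a] by (simp add: W_def)
    also have "dist (h z) (h a) = dist a z"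
      using that unfolding W_def isometries_def by (metis (mono_tags, lifting) dist_commute mem_Collect_eq)
    finally show ?thesis by simp
  qed
  have double: "\<exists>h' \<in> W. dist (h' z) z = 2 * dist (h z) z" if h: "h \<in> W" for h
  proof
    have iso: "bij h" "dist (h x) (h y) = dist x y" for x y
      using h by (auto simp: W_def isometries_def)
    \<comment> \<open>The commutator of \<open>h\<close> with the reflection doubles the displacement of the midpoint.\<close>
    define h' where "h' = \<psi> \<circ> inv h \<circ> \<psi> \<circ> h"
    have inv_fix: "inv h a = a" "inv h b = b"
      using h inv_f_f[OF bij_is_inj[OF iso(1)], of a] inv_f_f[OF bij_is_inj[OF iso(1)], of b]
      by (simp_all add: W_def)
    have "h' a = a" "h' b = b"
      using h by (auto simp: h'_def W_def \<psi>_def inv_fix)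
    then show "h' \<in> W"
      using h by (auto simp: W_def h'_def intro!: isometries_comp isometries_inv \<psi>)
    have "dist (h' z) z = dist (inv h (\<psi> (h z))) z"
      by (simp add: h'_def \<psi>z)
    also have "\<dots> = dist (\<psi> (h z)) (h z)"
      using iso(2)[of "inv h (\<psi> (h z))" z] iso(1) by (simp add: bij_is_surj surj_f_inv_f)
    finally show "dist (h' z) z = 2 * dist (h z) z"
      by (simp add: \<psi>z)
  qed
  \<comment> \<open>Iterating the doubling contradicts the bound unless \<open>g\<close> leaves the midpoint in place.\<close>
  have grow: "\<exists>h\<in>W. dist (h z) z = 2 ^ k * dist (g z) z" for k
  proof (induction k)
    case 0
    then show ?case using g by (auto simp: W_def)
  next
    case (Suc k)
    then obtain h where h: "h \<in> W" "dist (h z) z = 2 ^ k * dist (g z) z" by blast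
    then show ?case using double[OF h(1)] by (simp add: mult.assoc)
  qed
  have "dist (g z) z = 0"
  proof (rule ccontr)
    assume "dist (g z) z \<noteq> 0"
    then have pos: "dist (g z) z > 0" by simp
    obtain k where "2 * dist a z / dist (g z) z < 2 ^ k"
      using real_arch_pow[of 2 "2 * dist a z / dist (g z) z"] by auto
    then have "2 * dist a z < 2 ^ k * dist (g z) z"
      using pos by (simp add: pos_divide_less_eq)
    with grow[of k] bdd show False by fastforce
  qed
  then show ?thesis by (simp add: z_def)
qed

text \<open>
  Composing \<open>g\<close> with the reflections that exchange \<open>a\<close> with \<open>b\<close>, and \<open>g a\<close> with \<open>g b\<close>, reduces the claim to
  the case of fixed endpoints.
\<close>

lemma isometry_midpoint:
  fixes a b :: "'a::real_normed_vector"
  assumes g: "g \<in> isometries"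
  shows "g (midpoint a b) = midpoint (g a) (g b)"
proof -
  define \<psi> where "\<psi> = (\<lambda>x. a + b - x)"
  define \<phi> where "\<phi> = (\<lambda>x. g a + g b - x)"
  define h where "h = \<psi> \<circ> inv g \<circ> \<phi> \<circ> g"
  have bij: "bij g" using g by (simp add: isometries_def)
  have "h \<in> isometries"
    unfolding h_def \<psi>_def \<phi>_def
    by (intro isometries_comp isometries_inv point_reflection_isometries g)
  moreover have "h a = a" "h b = b"
    using bij by (simp_all add: h_def \<psi>_def \<phi>_def bij_is_inj inv_f_f)
  ultimately have "h (midpoint a b) = midpoint a b"
    by (rule isometry_fixes_midpoint)
  then have "inv g (g a + g b - g (midpoint a b)) = a + b - midpoint a b"
    by (simp add: h_def \<psi>_def \<phi>_def algebra_simps)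
  also have "a + b - midpoint a b = midpoint a b"
    by (simp add: midpoint_def scaleR_half_double[symmetric] algebra_simps)
       (metis scaleR_half_double scaleR_add_right add.commute add.left_commute)
  finally have "g a + g b - g (midpoint a b) = g (midpoint a b)"
    using bij by (metis bij_inv_eq_iff)
  then have "2 *\<^sub>R g (midpoint a b) = g a + g b"
    by (simp add: scaleR_2 algebra_simps)
  then have "(1/2) *\<^sub>R (2 *\<^sub>R g (midpoint a b)) = (1/2) *\<^sub>R (g a + g b)" by simp
  then show ?thesis by (simp add: midpoint_def)
qed

text \<open>
  An additive map is homogeneous over the rationals, and both sides of the homogeneity equation are
  continuous in the scalar.
\<close>

lemma continuous_additive_imp_linear:
  fixes A :: "'a::real_normed_vector \<Rightarrow> 'b::real_normed_vector"
  assumes add: "\<And>x y. A (x + y) = A x + A y" and cont: "continuous_on UNIV A"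
  shows "linear A"
proof (rule linearI)
  fix c :: real and x
  have A0: "A 0 = 0" using add[of 0 0] by simp
  have minus: "A (- y) = - A y" for y
    using add[of y "- y"] A0 by (simp add: eq_neg_iff_add_eq_0 add.commute)
  have nat: "A (real k *\<^sub>R y) = real k *\<^sub>R A y" for k y
    by (induction k) (simp_all add: A0 add scaleR_left_distrib)
  have int: "A (real_of_int k *\<^sub>R y) = real_of_int k *\<^sub>R A y" for k y
    using nat[of "nat k" y] nat[of "nat (- k)" "y"] minus[of "real (nat (- k)) *\<^sub>R y"]
    by (cases "k \<ge> 0") simp_all
  have rat: "A (q *\<^sub>R x) = q *\<^sub>R A x" if "q \<in> \<rat>" for q
  proof -
    obtain a b where q: "b > 0" "q = real_of_int a / real_of_int b"
      using \<open>q \<in> \<rat>\<close> by (metis Rats_cases')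
    have "real_of_int b *\<^sub>R A (q *\<^sub>R x) = A (real_of_int b *\<^sub>R q *\<^sub>R x)"
      by (simp only: int)
    also have "real_of_int b *\<^sub>R q *\<^sub>R x = real_of_int a *\<^sub>R x"
      using q by simp
    also have "A (real_of_int a *\<^sub>R x) = real_of_int b *\<^sub>R (q *\<^sub>R A x)"
      using q by (simp add: int)
    finally show ?thesis
      using q(1) by (subst (asm) scaleR_cancel_left) simp
  qed
  have "closed {c. A (c *\<^sub>R x) = c *\<^sub>R A x}"
    by (intro closed_Collect_eq continuous_intros continuous_on_compose2[OF cont]) auto
  then have "closure \<rat> \<subseteq> {c. A (c *\<^sub>R x) = c *\<^sub>R A x}"
    using rat by (intro closure_minimal) auto
  then show "A (c *\<^sub>R x) = c *\<^sub>R A x"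
    by (auto simp: Rats_closure_real)
qed (rule add)

definition linear_isometry :: "('a::real_normed_vector \<Rightarrow> 'a) \<Rightarrow> bool"
  where "linear_isometry A \<longleftrightarrow> linear A \<and> bij A \<and> (\<forall>x. norm (A x) = norm x)"

text \<open>
  The theorem of Mazur and Ulam: \<open>x \<mapsto> g x - g 0\<close> preserves midpoints and \<open>0\<close>, hence it is additive.
\<close>

lemma isometry_linear_part:
  fixes g :: "'a::real_normed_vector \<Rightarrow> 'a"
  assumes g: "g \<in> isometries"
  obtains A where "linear_isometry A" "\<And>x y. g x - g y = A (x - y)"
proof -
  define A where "A x = g x - g 0" for x
  have dA: "norm (A x - A y) = norm (x - y)" for x y
    using g by (simp add: isometries_def A_def dist_norm)
  have A0: "A 0 = 0" by (simp add: A_def)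
  have half: "A (midpoint a b) = midpoint (A a) (A b)" for a b
  proof -
    have "midpoint (A a) (A b) = (1/2) *\<^sub>R (g a + g b) - (1/2) *\<^sub>R (g 0 + g 0)"
      unfolding midpoint_def A_def scaleR_right_diff_distrib[symmetric]
      by (simp add: algebra_simps)
    moreover have "(1/2) *\<^sub>R (g 0 + g 0) = g 0"
      by (rule scaleR_half_double)
    ultimately show ?thesis
      using isometry_midpoint[OF g, of a b] by (simp add: A_def midpoint_def)
  qed
  have A_half: "A ((1/2) *\<^sub>R x) = (1/2) *\<^sub>R A x" for x
    using half[of x 0] by (simp add: midpoint_def A0)
  have add: "A (x + y) = A x + A y" for x y
  proof -
    have "(1/2) *\<^sub>R A (x + y) = (1/2) *\<^sub>R (A x + A y)"
      using half[of x y] A_half[of "x + y"] by (simp add: midpoint_def)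
    then show ?thesis by simp
  qed
  have "continuous_on UNIV A"
    using dA by (auto simp: continuous_on_iff dist_norm)
  then have "linear A"
    using add by (intro continuous_additive_imp_linear)
  moreover have "bij A"
  proof -
    have "A = (\<lambda>x. x - g 0) \<circ> g" by (auto simp: A_def)
    moreover have "bij (\<lambda>x. x - g 0)"
      by (rule o_bij[of "\<lambda>x. x + g 0"]) auto
    ultimately show ?thesis using g by (auto simp: isometries_def intro: bij_comp)
  qed
  ultimately have "linear_isometry A"
    using dA[of _ 0] A0 by (simp add: linear_isometry_def)
  moreover have "g x - g y = A (x - y)" for x y
    using linear_diff[OF \<open>linear A\<close>, of x y] by (simp add: A_def)
  ultimately show ?thesis by (rule that)
qed

section \<open>An inner product invariant under all linear isometries\<close>

lemma linear_isometry_id: "linear_isometry (\<lambda>x. x)"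
  by (simp add: linear_isometry_def linear_id[unfolded id_def] bij_id[unfolded id_def])

lemma linear_isometry_comp: "linear_isometry f \<Longrightarrow> linear_isometry g \<Longrightarrow> linear_isometry (f \<circ> g)"
  by (simp add: linear_isometry_def linear_compose bij_comp)

lemma linear_isometry_inv:
  assumes "linear_isometry f"
  shows "linear_isometry (inv f)"
proof -
  have f: "linear f" "bij f" "\<And>x. norm (f x) = norm x"
    using assms by (auto simp: linear_isometry_def)
  have ff: "f (inv f y) = y" "inv f (f x) = x" for x y
    using f(2) by (simp_all add: bij_is_surj surj_f_inv_f bij_is_inj inv_f_f)
  have "linear (inv f)"
    by (rule linearI; rule injD[OF bij_is_inj[OF f(2)]])
       (simp_all add: ff linear_add[OF f(1)] linear_scale[OF f(1)])
  then show ?thesis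
    using f(3)[of "inv f y" for y] ff f(2) by (auto simp: linear_isometry_def bij_imp_bij_inv)
qed

lemmas bilinear_simps =
  bilinear_ladd bilinear_radd bilinear_lsub bilinear_rsub bilinear_lmul bilinear_rmul
  bilinear_lneg bilinear_rneg bilinear_lzero bilinear_rzero

lemma inner_product_bilinear: "inner_product b \<Longrightarrow> bilinear b"
  and inner_product_sym: "inner_product b \<Longrightarrow> b x y = b y x"
  and inner_product_pos: "inner_product b \<Longrightarrow> x \<noteq> 0 \<Longrightarrow> b x x > 0"
  by (auto simp: inner_product_def)

lemma inner_product_nonneg: "inner_product b \<Longrightarrow> b x x \<ge> 0"
  using inner_product_pos[of b x] by (cases "x = 0") (auto simp: inner_product_def bilinear_simps)

lemma inner_product_Cauchy_Schwarz:
  assumes b: "inner_product b"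
  shows "(b x y)\<^sup>2 \<le> b x x * b y y"
proof (cases "y = 0")
  case True
  then show ?thesis using inner_product_bilinear[OF b] by (simp add: bilinear_simps)
next
  case False
  note bs = bilinear_simps[OF inner_product_bilinear[OF b]]
  have "0 \<le> b (b y y *\<^sub>R x - b x y *\<^sub>R y) (b y y *\<^sub>R x - b x y *\<^sub>R y)"
    by (rule inner_product_nonneg[OF b])
  also have "\<dots> = b y y * (b x x * b y y - (b x y)\<^sup>2)"
    by (simp add: bs inner_product_sym[OF b, of y x] algebra_simps power2_eq_square)
  finally show ?thesis
    using inner_product_pos[OF b False] by (simp add: zero_le_mult_iff)
qed

lemma inner_product_bounded:
  fixes b :: "'a::real_normed_vector \<Rightarrow> 'a \<Rightarrow> real"
  assumes b: "inner_product b" and bound: "\<And>x. b x x \<le> M * (norm x)\<^sup>2"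
  shows "bounded_bilinear b" "\<bar>b x y\<bar> \<le> \<bar>M\<bar> * norm x * norm y"
proof -
  have le: "\<bar>b x y\<bar> \<le> \<bar>M\<bar> * norm x * norm y" for x y
  proof -
    have bound': "b x x \<le> \<bar>M\<bar> * (norm x)\<^sup>2" for x
      using bound[of x] mult_right_mono[of M "\<bar>M\<bar>" "(norm x)\<^sup>2"]
      by (meson abs_ge_self order_trans zero_le_power2)
    have "(b x y)\<^sup>2 \<le> b x x * b y y"
      by (rule inner_product_Cauchy_Schwarz[OF b])
    also have "\<dots> \<le> (\<bar>M\<bar> * (norm x)\<^sup>2) * (\<bar>M\<bar> * (norm y)\<^sup>2)"
      by (intro mult_mono bound' inner_product_nonneg[OF b]) simp
    also have "\<dots> = (\<bar>M\<bar> * norm x * norm y)\<^sup>2"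
      by (simp add: power2_eq_square)
    finally show ?thesis
      by (rule abs_le_square_iff[THEN iffD2, THEN order_trans]) simp
  qed
  then show "\<bar>b x y\<bar> \<le> \<bar>M\<bar> * norm x * norm y" .
  show "bounded_bilinear b"
    using le
    by unfold_locales
       (auto simp: bilinear_simps[OF inner_product_bilinear[OF b]] mult_ac intro!: exI[of _ "\<bar>M\<bar>"])
qed

text \<open>
  Polarisation expresses the inner product through the norm.
\<close>

lemma euclidean_inner_product_invariant:
  assumes ip: "inner_product b" and norm_b: "\<And>x. norm x = sqrt (b x x)"
    and A: "linear_isometry A"
  shows "b (A x) (A y) = b x y"
proof -
  have sq: "b x x = (norm x)\<^sup>2" for x
    unfolding norm_b using inner_product_nonneg[OF ip, of x] by simp
  have polar: "2 * b x y = (norm (x + y))\<^sup>2 - (norm x)\<^sup>2 - (norm y)\<^sup>2" for x y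
    unfolding sq[symmetric] bilinear_simps[OF inner_product_bilinear[OF ip]]
    by (simp add: inner_product_sym[OF ip, of y x])
  have "linear A" and nA: "norm (A x) = norm x" for x
    using A by (simp_all add: linear_isometry_def)
  have "2 * b (A x) (A y) = 2 * b x y"
    unfolding polar linear_add[OF \<open>linear A\<close>, symmetric] nA ..
  then show ?thesis by simp
qed

text \<open>
  The invariant inner product is found in this convex set of forms. It is stable under linear isometries
  because its defining bounds refer to the norm, and for \<open>m > 0\<close> a pointwise limit of its members is still
  positive definite.
\<close>

definition pinched_forms :: "real \<Rightarrow> real \<Rightarrow> ('a::real_normed_vector \<Rightarrow> 'a \<Rightarrow> real) set"
  where "pinched_forms m M = {Q. bilinear Q \<and> (\<forall>x y. Q x y = Q y x) \<and>
    (\<forall>x. m * (norm x)\<^sup>2 \<le> Q x x \<and> Q x x \<le> M * (norm x)\<^sup>2)}"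

lemma pinched_forms_inner_product:
  assumes "m > 0" "Q \<in> pinched_forms m M"
  shows "inner_product Q"
proof -
  have "Q x x > 0" if "x \<noteq> 0" for x
  proof -
    have "0 < m * (norm x)\<^sup>2" using assms(1) that by simp
    also have "\<dots> \<le> Q x x" using assms(2) by (simp add: pinched_forms_def)
    finally show ?thesis .
  qed
  then show ?thesis using assms(2) by (simp add: pinched_forms_def inner_product_def)
qed

lemma pinched_forms_midpoint:
  assumes "P \<in> pinched_forms m M" "Q \<in> pinched_forms m M"
  shows "(\<lambda>x y. (P x y + Q x y) / 2) \<in> pinched_forms m M"
proof -
  have "bilinear P" "bilinear Q"
    and le: "m * (norm x)\<^sup>2 \<le> P x x" "P x x \<le> M * (norm x)\<^sup>2"
      "m * (norm x)\<^sup>2 \<le> Q x x" "Q x x \<le> M * (norm x)\<^sup>2" for x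
    using assms by (auto simp: pinched_forms_def)
  moreover have "bilinear (\<lambda>x y. (P x y + Q x y) / 2)"
    unfolding bilinear_def
    by (auto intro!: linearI simp: bilinear_simps[OF \<open>bilinear P\<close>] bilinear_simps[OF \<open>bilinear Q\<close>]
        field_simps)
  moreover have "m * (norm x)\<^sup>2 \<le> (P x x + Q x x) / 2" "(P x x + Q x x) / 2 \<le> M * (norm x)\<^sup>2" for x
    using le[of x] by (simp_all only: pos_le_divide_eq pos_divide_le_eq zero_less_numeral)
  ultimately show ?thesis
    using assms by (auto simp: pinched_forms_def)
qed

lemma pinched_forms_linear_isometry:
  assumes "Q \<in> pinched_forms m M" "linear_isometry A"
  shows "(\<lambda>x y. Q (A x) (A y)) \<in> pinched_forms m M"
proof -
  have "bilinear Q" using assms(1) by (simp add: pinched_forms_def)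
  have "linear A" "\<And>x. norm (A x) = norm x"
    using assms(2) by (auto simp: linear_isometry_def)
  moreover have "bilinear (\<lambda>x y. Q (A x) (A y))"
    unfolding bilinear_def
    by (auto intro!: linearI simp: bilinear_simps[OF \<open>bilinear Q\<close>]
        linear_add[OF \<open>linear A\<close>] linear_scale[OF \<open>linear A\<close>])
  moreover have "m * (norm (A x))\<^sup>2 \<le> Q (A x) (A x)" "Q (A x) (A x) \<le> M * (norm (A x))\<^sup>2" for x
    using assms(1) by (auto simp: pinched_forms_def)
  ultimately show ?thesis
    using assms(1) by (simp add: pinched_forms_def)
qed

text \<open>
  The squared Hilbert-Schmidt norm of \<open>Q\<close> for the inner product in which the transported basis \<open>A ` B\<close> is
  orthonormal.
\<close>

definition gram_energy :: "'a set \<Rightarrow> ('a \<Rightarrow> 'a) \<Rightarrow> ('a \<Rightarrow> 'a \<Rightarrow> real) \<Rightarrow> real"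
  where "gram_energy B A Q = (\<Sum>(v, w)\<in>B \<times> B. (Q (A v) (A w))\<^sup>2)"

text \<open>
  The supremum over all linear isometries makes the energy of a form invariant while keeping it uniformly
  convex. Minimising it plays the part of averaging over the isometry group.
\<close>

definition orbit_energy :: "'a::real_normed_vector set \<Rightarrow> ('a \<Rightarrow> 'a \<Rightarrow> real) \<Rightarrow> real"
  where "orbit_energy B Q = (SUP A\<in>Collect linear_isometry. gram_energy B A Q)"

lemma gram_energy_parallelogram:
  "gram_energy B A (\<lambda>x y. (P x y + Q x y) / 2) =
    (gram_energy B A P + gram_energy B A Q) / 2 - gram_energy B A (\<lambda>x y. P x y - Q x y) / 4"
  unfolding gram_energy_def sum.distrib[symmetric] sum_divide_distrib sum_subtractf[symmetric]
  by (intro sum.cong) (auto simp: power2_eq_square field_simps)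

lemma bdd_above_gram_energy:
  fixes Q :: "'a::real_normed_vector \<Rightarrow> 'a \<Rightarrow> real"
  assumes "m > 0" "Q \<in> pinched_forms m M"
  shows "bdd_above ((\<lambda>A. gram_energy B A Q) ` Collect linear_isometry)"
proof (rule bdd_aboveI2)
  fix A :: "'a \<Rightarrow> 'a" assume A: "A \<in> Collect linear_isometry"
  have "(Q (A v) (A w))\<^sup>2 \<le> (\<bar>M\<bar> * norm v * norm w)\<^sup>2" for v w
  proof -
    have "\<bar>Q (A v) (A w)\<bar> \<le> \<bar>M\<bar> * norm (A v) * norm (A w)"
      using assms
      by (intro inner_product_bounded pinched_forms_inner_product) (auto simp: pinched_forms_def)
    then show ?thesis
      using A abs_le_square_iff[of "Q (A v) (A w)" "\<bar>M\<bar> * norm v * norm w"]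
      by (simp add: linear_isometry_def abs_mult)
  qed
  then show "gram_energy B A Q \<le> (\<Sum>(v, w)\<in>B \<times> B. (\<bar>M\<bar> * norm v * norm w)\<^sup>2)"
    unfolding gram_energy_def by (intro sum_mono) auto
qed

lemma gram_energy_le_orbit_energy:
  assumes "m > 0" "Q \<in> pinched_forms m M" "linear_isometry A"
  shows "gram_energy B A Q \<le> orbit_energy B Q"
  unfolding orbit_energy_def
  by (rule cSUP_upper[OF _ bdd_above_gram_energy[OF assms(1,2)]]) (simp add: assms(3))

lemma orbit_energy_linear_isometry:
  assumes "m > 0" "Q \<in> pinched_forms m M" "linear_isometry A"
  shows "orbit_energy B (\<lambda>x y. Q (A x) (A y)) \<le> orbit_energy B Q"
  unfolding orbit_energy_def[of B "\<lambda>x y. Q (A x) (A y)"]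
proof (rule cSUP_least)
  show "Collect linear_isometry \<noteq> ({} :: ('a \<Rightarrow> 'a) set)"
    using linear_isometry_id by blast
  fix A' assume "A' \<in> Collect (linear_isometry :: ('a \<Rightarrow> 'a) \<Rightarrow> bool)"
  then have "linear_isometry (A \<circ> A')"
    using assms(3) by (simp add: linear_isometry_comp)
  then have "gram_energy B (A \<circ> A') Q \<le> orbit_energy B Q"
    by (rule gram_energy_le_orbit_energy[OF assms(1,2)])
  then show "gram_energy B A' (\<lambda>x y. Q (A x) (A y)) \<le> orbit_energy B Q"
    by (simp add: gram_energy_def)
qed

text \<open>
  The constant does not depend on the linear isometry \<open>A\<close>: writing \<open>x = A y\<close>, the coordinates of \<open>x\<close> in the
  transported basis are those of \<open>y\<close> in \<open>B\<close>, and \<open>norm y = norm x\<close>.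
\<close>

lemma quadratic_form_le_gram_energy:
  fixes B :: "'a::real_normed_vector set"
  assumes B: "independent B" "finite B" "span B = UNIV"
  obtains K where "K > 0"
    "\<And>A D x. linear_isometry A \<Longrightarrow> bilinear D \<Longrightarrow> (D x x)\<^sup>2 \<le> K * norm x ^ 4 * gram_energy B A D"
proof -
  obtain C where C: "C > 0" "\<And>x. (\<Sum>v\<in>B. \<bar>representation B x v\<bar>) \<le> C * norm x"
    using coordinates_bounded[OF B] by blast
  \<comment> \<open>The summand \<open>1\<close> keeps \<open>K\<close> positive when \<open>B\<close> is empty.\<close>
  define K where "K = C ^ 4 * (real (card (B \<times> B)) + 1)"
  have "(D x x)\<^sup>2 \<le> K * norm x ^ 4 * gram_energy B A D"
    if A: "linear_isometry A" and D: "bilinear D" for A D and x :: 'a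
  proof -
    have lin: "linear A" and bij: "bij A" and nA: "\<And>y. norm (A y) = norm y"
      using A by (auto simp: linear_isometry_def)
    obtain y where y: "x = A y" using bij by (meson bij_pointE)
    have ny: "norm y = norm x" using nA y by simp
    let ?r = "representation B y"
    have r: "\<bar>?r v\<bar> \<le> C * norm x" if "v \<in> B" for v
    proof -
      have "\<bar>?r v\<bar> \<le> (\<Sum>v\<in>B. \<bar>?r v\<bar>)"
        using member_le_sum[of v B "\<lambda>v. \<bar>?r v\<bar>"] that B(2) by simp
      with C(2)[of y] ny show ?thesis by simp
    qed
    have "x = (\<Sum>v\<in>B. ?r v *\<^sub>R A v)"
      using sum_representation_UNIV[OF B, of y] y
      by (metis (no_types, lifting) linear_sum[OF lin] linear_scale[OF lin] sum.cong)
    then have "D x x = D (\<Sum>v\<in>B. ?r v *\<^sub>R A v) (\<Sum>v\<in>B. ?r v *\<^sub>R A v)"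
      by simp
    also have "\<dots> = (\<Sum>(v, w)\<in>B \<times> B. (?r v * ?r w) * D (A v) (A w))"
      unfolding bilinear_sum[OF D]
      by (intro sum.cong refl) (auto simp: bilinear_simps[OF D])
    finally have Dx: "D x x = (\<Sum>z\<in>B \<times> B. (?r (fst z) * ?r (snd z)) * D (A (fst z)) (A (snd z)))"
      by (simp add: case_prod_beta)
    have "(D x x)\<^sup>2 \<le> (\<Sum>z\<in>B \<times> B. (?r (fst z) * ?r (snd z))\<^sup>2) *
        (\<Sum>z\<in>B \<times> B. (D (A (fst z)) (A (snd z)))\<^sup>2)"
      unfolding Dx by (rule Cauchy_Schwarz_ineq_sum)
    also have "\<dots> = (\<Sum>z\<in>B \<times> B. (?r (fst z) * ?r (snd z))\<^sup>2) * gram_energy B A D"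
      by (simp add: gram_energy_def case_prod_beta)
    also have "\<dots> \<le> (K * norm x ^ 4) * gram_energy B A D"
    proof (rule mult_right_mono)
      have "(?r (fst z) * ?r (snd z))\<^sup>2 \<le> (C * norm x) ^ 4" if "z \<in> B \<times> B" for z
      proof -
        have "\<bar>?r (fst z) * ?r (snd z)\<bar> \<le> (C * norm x) * (C * norm x)"
          unfolding abs_mult using that C(1) by (intro mult_mono r) auto
        then have "(?r (fst z) * ?r (snd z))\<^sup>2 \<le> ((C * norm x) * (C * norm x))\<^sup>2"
          using C(1) by (subst abs_le_square_iff[symmetric]) (simp add: abs_mult)
        then show ?thesis by (simp add: power2_eq_square power4_eq_xxxx mult_ac)
      qed
      then have "(\<Sum>z\<in>B \<times> B. (?r (fst z) * ?r (snd z))\<^sup>2) \<le> real (card (B \<times> B)) * (C * norm x) ^ 4"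
        by (rule sum_bounded_above)
      also have "\<dots> \<le> K * norm x ^ 4"
        using C(1) by (simp add: K_def power_mult_distrib algebra_simps)
      finally show "(\<Sum>z\<in>B \<times> B. (?r (fst z) * ?r (snd z))\<^sup>2) \<le> K * norm x ^ 4" .
      show "0 \<le> gram_energy B A D"
        unfolding gram_energy_def by (intro sum_nonneg) auto
    qed
    finally show ?thesis .
  qed
  moreover have "K > 0" using C(1) by (simp add: K_def add_nonneg_pos)
  ultimately show ?thesis using that by blast
qed

text \<open>
  For each single isometry the energy satisfies the parallelogram law, and the term that is lost in it
  dominates \<open>(P x x - Q x x)\<^sup>2\<close> uniformly in the isometry. A bound with a
  uniform margin passes to the supremum even where the supremum is not attained.
\<close>

lemma orbit_energy_uniformly_convex:
  fixes B :: "'a::real_normed_vector set"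
  assumes B: "independent B" "finite B" "span B = UNIV" and m: "m > 0"
  obtains K where "K > 0"
    "\<And>P Q x. P \<in> pinched_forms m M \<Longrightarrow> Q \<in> pinched_forms m M \<Longrightarrow>
      (P x x - Q x x)\<^sup>2 \<le> K * norm x ^ 4 *
        ((orbit_energy B P + orbit_energy B Q) / 2 - orbit_energy B (\<lambda>x y. (P x y + Q x y) / 2))"
proof -
  obtain K where K: "K > 0"
    "\<And>A D x. linear_isometry A \<Longrightarrow> bilinear D \<Longrightarrow> (D x x)\<^sup>2 \<le> K * norm x ^ 4 * gram_energy B A D"
    using quadratic_form_le_gram_energy[OF B] by blast
  have "(P x x - Q x x)\<^sup>2 \<le> 4 * K * norm x ^ 4 *
        ((orbit_energy B P + orbit_energy B Q) / 2 - orbit_energy B (\<lambda>x y. (P x y + Q x y) / 2))"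
    if P: "P \<in> pinched_forms m M" and Q: "Q \<in> pinched_forms m M" for P Q and x :: 'a
  proof (cases "x = 0")
    case True
    then show ?thesis
      using P Q by (simp add: pinched_forms_def bilinear_simps)
  next
    case False
    define k where "k = K * norm x ^ 4"
    have k: "k > 0" using False K(1) by (simp add: k_def)
    have D: "bilinear (\<lambda>x y. P x y - Q x y)"
    proof -
      have "bilinear P" "bilinear Q" using P Q by (auto simp: pinched_forms_def)
      then show ?thesis
        unfolding bilinear_def linear_iff by (auto simp: algebra_simps)
    qed
    have "orbit_energy B (\<lambda>x y. (P x y + Q x y) / 2) \<le>
        (orbit_energy B P + orbit_energy B Q) / 2 - (P x x - Q x x)\<^sup>2 / (4 * k)"
      unfolding orbit_energy_def[of B "\<lambda>x y. (P x y + Q x y) / 2"]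
    proof (rule cSUP_least)
      show "Collect linear_isometry \<noteq> ({} :: ('a \<Rightarrow> 'a) set)"
        using linear_isometry_id by blast
      fix A assume "A \<in> Collect (linear_isometry :: ('a \<Rightarrow> 'a) \<Rightarrow> bool)"
      then have A: "linear_isometry A" by simp
      have "(P x x - Q x x)\<^sup>2 / (4 * k) \<le> gram_energy B A (\<lambda>x y. P x y - Q x y) / 4"
        using K(2)[OF A D, of x] k by (simp add: k_def[symmetric] field_simps)
      moreover have "gram_energy B A P \<le> orbit_energy B P" "gram_energy B A Q \<le> orbit_energy B Q"
        using gram_energy_le_orbit_energy m P Q A by blast+
      ultimately show "gram_energy B A (\<lambda>x y. (P x y + Q x y) / 2) \<le>
          (orbit_energy B P + orbit_energy B Q) / 2 - (P x x - Q x x)\<^sup>2 / (4 * k)"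
        unfolding gram_energy_parallelogram by argo
    qed
    then have "(P x x - Q x x)\<^sup>2 / (4 * k) \<le>
        (orbit_energy B P + orbit_energy B Q) / 2 - orbit_energy B (\<lambda>x y. (P x y + Q x y) / 2)"
      by simp
    then show ?thesis
      using k by (simp add: divide_le_eq k_def mult_ac)
  qed
  then show ?thesis using that[of "4 * K"] K(1) by simp
qed

text \<open>
  The standard form in the coordinates of \<open>B\<close>, which is comparable with the squared norm.
\<close>

lemma pinched_form_exists:
  fixes B :: "'a::real_normed_vector set"
  assumes B: "independent B" "finite B" "span B = UNIV"
  obtains m M and Q :: "'a \<Rightarrow> 'a \<Rightarrow> real" where "m > 0" "Q \<in> pinched_forms m M"
proof -
  obtain C where C: "C > 0" "\<And>x. (\<Sum>v\<in>B. \<bar>representation B x v\<bar>) \<le> C * norm x"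
    using coordinates_bounded[OF B] by blast
  define Q where "Q x y = (\<Sum>v\<in>B. representation B x v * representation B y v)" for x y
  \<comment> \<open>The summand \<open>1\<close> keeps \<open>s\<close> positive when \<open>B\<close> is empty.\<close>
  define s where "s = (\<Sum>v\<in>B. (norm v)\<^sup>2) + 1"
  have s: "s > 0" by (simp add: s_def add_nonneg_pos sum_nonneg)
  have rep: "representation B (x + y) v = representation B x v + representation B y v"
    "representation B (c *\<^sub>R x) v = c * representation B x v" for x y v c
    using B by (simp_all add: representation_add representation_scale)
  have "bilinear Q"
    unfolding bilinear_def
    by (auto intro!: linearI simp: Q_def rep algebra_simps sum.distrib sum_distrib_left)
  moreover have "Q x y = Q y x" for x y
    by (simp add: Q_def mult.commute)
  moreover have "Q x x \<le> C\<^sup>2 * (norm x)\<^sup>2" for x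
  proof -
    have "Q x x = (\<Sum>v\<in>B. \<bar>representation B x v\<bar> * \<bar>representation B x v\<bar>)"
      by (simp add: Q_def)
    also have "\<dots> \<le> (\<Sum>v\<in>B. \<bar>representation B x v\<bar> * (\<Sum>v\<in>B. \<bar>representation B x v\<bar>))"
      using B(2) by (intro sum_mono mult_left_mono member_le_sum) auto
    also have "\<dots> = (\<Sum>v\<in>B. \<bar>representation B x v\<bar>)\<^sup>2"
      by (simp add: sum_distrib_right power2_eq_square)
    also have "\<dots> \<le> (C * norm x)\<^sup>2"
      by (intro power_mono C sum_nonneg) auto
    finally show ?thesis by (simp add: power_mult_distrib)
  qed
  moreover have "(1/s) * (norm x)\<^sup>2 \<le> Q x x" for x
  proof -
    have "norm x = norm (\<Sum>v\<in>B. representation B x v *\<^sub>R v)"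
      using sum_representation_UNIV[OF B] by simp
    also have "\<dots> \<le> (\<Sum>v\<in>B. \<bar>representation B x v\<bar> * norm v)"
      by (rule order_trans[OF norm_sum]) simp
    finally have "(norm x)\<^sup>2 \<le> (\<Sum>v\<in>B. \<bar>representation B x v\<bar> * norm v)\<^sup>2"
      by (rule power_mono) simp
    also have "\<dots> \<le> (\<Sum>v\<in>B. \<bar>representation B x v\<bar>\<^sup>2) * (\<Sum>v\<in>B. (norm v)\<^sup>2)"
      by (rule Cauchy_Schwarz_ineq_sum)
    also have "(\<Sum>v\<in>B. \<bar>representation B x v\<bar>\<^sup>2) = Q x x"
      by (simp add: Q_def power2_eq_square)
    also have "Q x x * (\<Sum>v\<in>B. (norm v)\<^sup>2) \<le> Q x x * s"
      by (intro mult_left_mono) (auto simp: s_def Q_def intro!: sum_nonneg)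
    finally show ?thesis using s by (simp add: field_simps)
  qed
  ultimately have "Q \<in> pinched_forms (1/s) (C\<^sup>2)"
    by (simp add: pinched_forms_def)
  then show ?thesis using that[of "1/s"] s by simp
qed

text \<open>
  By uniform convexity two forms in the pinched set whose orbit energies are nearly minimal are close to each
  other. Hence a minimising sequence is a Cauchy sequence, and since a linear isometry maps it to another
  minimising sequence, its limit is invariant.
\<close>

lemma invariant_inner_product_exists:
  fixes B :: "'a::real_normed_vector set"
  assumes B: "independent B" "finite B" "span B = UNIV"
  obtains b :: "'a \<Rightarrow> 'a \<Rightarrow> real" where "inner_product b" "bounded_bilinear b"
    "\<And>A x y. linear_isometry A \<Longrightarrow> b (A x) (A y) = b x y"
proof -
  obtain m M and Q0 :: "'a \<Rightarrow> 'a \<Rightarrow> real" where m: "m > 0" and Q0: "Q0 \<in> pinched_forms m M"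
    using pinched_form_exists[OF B] by blast
  let ?F = "pinched_forms m M :: ('a \<Rightarrow> 'a \<Rightarrow> real) set"
  define E where "E = orbit_energy B"
  define I where "I = (INF Q\<in>?F. E Q)"
  have Epos: "0 \<le> E Q" if "Q \<in> ?F" for Q
  proof -
    have "0 \<le> gram_energy B (\<lambda>x. x) Q"
      unfolding gram_energy_def by (intro sum_nonneg) auto
    also have "\<dots> \<le> E Q"
      unfolding E_def by (rule gram_energy_le_orbit_energy[OF m that linear_isometry_id])
    finally show ?thesis .
  qed
  then have bdd: "bdd_below (E ` ?F)" by (rule bdd_belowI2)
  obtain K where K: "K > 0"
    "\<And>P Q x. P \<in> ?F \<Longrightarrow> Q \<in> ?F \<Longrightarrow>
      (P x x - Q x x)\<^sup>2 \<le> K * norm x ^ 4 * ((E P + E Q) / 2 - E (\<lambda>x y. (P x y + Q x y) / 2))"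
    using orbit_energy_uniformly_convex[OF B m, of M] unfolding E_def by blast
  have close: "(P x x - Q x x)\<^sup>2 \<le> K * norm x ^ 4 * e"
    if PQ: "P \<in> ?F" "Q \<in> ?F" and e: "E P \<le> I + e" "E Q \<le> I + e" for P Q e x
  proof -
    have "I \<le> E (\<lambda>x y. (P x y + Q x y) / 2)"
      unfolding I_def by (rule cINF_lower[OF bdd pinched_forms_midpoint[OF PQ]])
    then have "(E P + E Q) / 2 - E (\<lambda>x y. (P x y + Q x y) / 2) \<le> e"
      using e by argo
    then have "K * norm x ^ 4 * ((E P + E Q) / 2 - E (\<lambda>x y. (P x y + Q x y) / 2)) \<le>
        K * norm x ^ 4 * e"
      using K(1) by (intro mult_left_mono) auto
    with K(2)[OF PQ, of x] show ?thesis by linarith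
  qed
  have "\<exists>Q\<in>?F. E Q \<le> I + inverse (real (Suc k))" for k
  proof -
    have "(INF Q\<in>?F. E Q) < I + inverse (real (Suc k))"
      by (simp add: I_def)
    then show ?thesis
      using cINF_less_iff[of ?F E] Q0 bdd by (auto intro: less_imp_le)
  qed
  then obtain Q where Q: "\<And>k. Q k \<in> ?F" "\<And>k. E (Q k) \<le> I + inverse (real (Suc k))"
    by metis
  have Qb: "bilinear (Q k)" and Qsym: "Q k x y = Q k y x"
    and Qm: "m * (norm x)\<^sup>2 \<le> Q k x x" and QM: "Q k x x \<le> M * (norm x)\<^sup>2" for k x y
    using Q(1)[of k] by (auto simp: pinched_forms_def)
  have "Cauchy (\<lambda>k. Q k x x)" for x
  proof (rule metric_CauchyI)
    fix e :: real assume e: "e > 0"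
    define c where "c = K * norm x ^ 4"
    have c: "c \<ge> 0" using K(1) by (simp add: c_def)
    obtain N where N: "inverse (real (Suc N)) < e\<^sup>2 / (c + 1)"
      using reals_Archimedean[of "e\<^sup>2 / (c + 1)"] e c by auto
    show "\<exists>N. \<forall>k\<ge>N. \<forall>l\<ge>N. dist (Q k x x) (Q l x x) < e"
    proof (intro exI allI impI)
      fix k l assume "k \<ge> N" "l \<ge> N"
      then have "inverse (real (Suc k)) \<le> inverse (real (Suc N))"
        "inverse (real (Suc l)) \<le> inverse (real (Suc N))"
        by (auto intro!: le_imp_inverse_le)
      then have "E (Q k) \<le> I + inverse (real (Suc N))" "E (Q l) \<le> I + inverse (real (Suc N))"
        using Q(2)[of k] Q(2)[of l] by linarith+
      then have "(Q k x x - Q l x x)\<^sup>2 \<le> c * inverse (real (Suc N))"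
        unfolding c_def by (intro close Q(1))
      also have "\<dots> \<le> (c + 1) * inverse (real (Suc N))"
        by (intro mult_right_mono) auto
      also have "\<dots> < e\<^sup>2"
        using N c by (simp add: field_simps)
      finally show "dist (Q k x x) (Q l x x) < e"
        using e by (simp add: dist_real_def) (metis abs_le_square_iff abs_of_pos not_le)
    qed
  qed
  then have conv: "convergent (\<lambda>k. Q k x x)" for x
    by (simp add: Cauchy_convergent_iff)
  \<comment> \<open>Polarisation carries the convergence from the diagonal to all pairs.\<close>
  have polar: "Q k x y = (Q k (x + y) (x + y) - Q k x x - Q k y y) / 2" for k x y
    using Qsym[of k x y] by (simp add: bilinear_simps[OF Qb])
  define b where "b x y = lim (\<lambda>k. Q k x y)" for x y
  have lim: "(\<lambda>k. Q k x y) \<longlonglongrightarrow> b x y" for x y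
  proof -
    obtain q where q: "\<And>z. (\<lambda>k. Q k z z) \<longlonglongrightarrow> q z"
      using conv unfolding convergent_def by metis
    have "convergent (\<lambda>k. Q k x y)"
      unfolding polar[of _ x y] convergent_def
      by (intro exI[of _ "(q (x + y) - q x - q y) / 2"] tendsto_intros q) simp
    then show ?thesis by (simp add: b_def convergent_LIMSEQ_iff)
  qed
  have uniq: "l = b x y" if "(\<lambda>k. Q k x y) \<longlonglongrightarrow> l" for l x y
    by (rule LIMSEQ_unique[OF that lim])
  have "b (x + y) z = b x z + b y z" "b (c *\<^sub>R x) z = c * b x z" for x y z c
    using tendsto_add[OF lim[of x z] lim[of y z]] tendsto_mult_left[OF lim[of x z], of c]
    by (auto intro!: uniq[symmetric] simp: bilinear_simps[OF Qb])
  moreover have bsym: "b x y = b y x" for x y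
    by (rule uniq) (use lim[of x y] in \<open>simp add: Qsym[of _ x y]\<close>)
  ultimately have "bilinear b"
    unfolding bilinear_def by (auto intro!: linearI)
  moreover have "m * (norm x)\<^sup>2 \<le> b x x" "b x x \<le> M * (norm x)\<^sup>2" for x
    using Qm QM by (auto intro: LIMSEQ_le_const[OF lim] LIMSEQ_le_const2[OF lim])
  ultimately have b: "b \<in> ?F"
    using bsym by (simp add: pinched_forms_def)
  then have ip: "inner_product b" by (rule pinched_forms_inner_product[OF m])
  moreover have "bounded_bilinear b"
    by (rule inner_product_bounded(1)[OF ip, of M]) (use b in \<open>simp add: pinched_forms_def\<close>)
  moreover have "b (A x) (A y) = b x y" if A: "linear_isometry A" for A x y
  proof -
    have diag: "b (A x) (A x) = b x x" for x
    proof -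
      have "(Q k (A x) (A x) - Q k x x)\<^sup>2 \<le> K * norm x ^ 4 * inverse (real (Suc k))" for k
      proof -
        have "(\<lambda>x y. Q k (A x) (A y)) \<in> ?F"
          by (rule pinched_forms_linear_isometry[OF Q(1) A])
        moreover have "E (\<lambda>x y. Q k (A x) (A y)) \<le> I + inverse (real (Suc k))"
          using orbit_energy_linear_isometry[OF m Q(1) A, of B k] Q(2)[of k]
          by (simp add: E_def)
        ultimately show ?thesis
          using close[OF _ Q(1)[of k] _ Q(2)[of k], of "\<lambda>x y. Q k (A x) (A y)" x] by simp
      qed
      moreover have "(\<lambda>k. (Q k (A x) (A x) - Q k x x)\<^sup>2) \<longlonglongrightarrow> (b (A x) (A x) - b x x)\<^sup>2"
        by (intro tendsto_intros lim)
      moreover have "(\<lambda>k. K * norm x ^ 4 * inverse (real (Suc k))) \<longlonglongrightarrow> K * norm x ^ 4 * 0"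
        by (intro tendsto_intros LIMSEQ_inverse_real_of_nat)
      ultimately have "(b (A x) (A x) - b x x)\<^sup>2 \<le> K * norm x ^ 4 * 0"
        using LIMSEQ_le by blast
      then show ?thesis by simp
    qed
    have "linear A" using A by (simp add: linear_isometry_def)
    have "2 * b x y = b (x + y) (x + y) - b x x - b y y" for x y
      using bsym[of x y] by (simp add: bilinear_simps[OF inner_product_bilinear[OF ip]])
    from this[of x y] this[of "A x" "A y"] show ?thesis
      using diag[of "x + y"] by (simp add: diag linear_add[OF \<open>linear A\<close>])
  qed
  ultimately show ?thesis by (rule that)
qed

section \<open>Orthonormal frames\<close>

definition orthonormal_set :: "('a \<Rightarrow> 'a \<Rightarrow> real) \<Rightarrow> 'a set \<Rightarrow> bool"
  where "orthonormal_set b E \<longleftrightarrow> (\<forall>e\<in>E. \<forall>f\<in>E. b e f = (if e = f then 1 else 0))"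

lemma bilinear_sum_left: "bilinear b \<Longrightarrow> b (\<Sum>i\<in>I. f i) y = (\<Sum>i\<in>I. b (f i) y)"
  unfolding bilinear_def using linear_sum by blast

lemma orthonormal_set_independent:
  fixes b :: "'a::real_vector \<Rightarrow> 'a \<Rightarrow> real"
  assumes b: "bilinear b" and E: "orthonormal_set b E"
  shows "independent E"
  unfolding independent_explicit_module
proof (intro allI impI)
  fix t u v
  assume t: "finite t" "t \<subseteq> E" "(\<Sum>w\<in>t. u w *\<^sub>R w) = 0" "v \<in> t"
  have "0 = b (\<Sum>w\<in>t. u w *\<^sub>R w) v"
    using t(3) by (simp add: bilinear_simps[OF b])
  also have "\<dots> = (\<Sum>w\<in>t. if w = v then u w else 0)"
    unfolding bilinear_sum_left[OF b]
  proof (intro sum.cong refl)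
    fix w assume "w \<in> t"
    then have "b w v = (if w = v then 1 else 0)"
      using E t(2,4) unfolding orthonormal_set_def by blast
    then show "b (u w *\<^sub>R w) v = (if w = v then u w else 0)"
      by (simp add: bilinear_simps[OF b])
  qed
  finally show "u v = 0" using t(1,4) by simp
qed

text \<open>
  The Gram-Schmidt process: an orthonormal set is extended by the normalised component of the next vector
  orthogonal to it.
\<close>

lemma orthonormal_set_extend:
  fixes b :: "'a::real_vector \<Rightarrow> 'a \<Rightarrow> real"
  assumes ip: "inner_product b" and E: "finite E" "orthonormal_set b E" and "finite A"
  shows "\<exists>E'. finite E' \<and> E \<subseteq> E' \<and> orthonormal_set b E' \<and> span E' = span (E \<union> A)"
  using \<open>finite A\<close>
proof (induction A)
  case empty
  then show ?case using E by (intro exI[of _ E]) auto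
next
  case (insert a A)
  note b = inner_product_bilinear[OF ip]
  obtain E' where E': "finite E'" "E \<subseteq> E'" "orthonormal_set b E'" "span E' = span (E \<union> A)"
    using insert.IH by blast
  have span_insert: "span (insert a E') = span (E \<union> insert a A)"
    using E'(4) by (simp add: span_insert)
  show ?case
  proof (cases "a \<in> span E'")
    case True
    then have "span (insert a E') = span E'" by (rule span_redundant)
    then show ?thesis using E' span_insert by auto
  next
    case False
    \<comment> \<open>The Gram-Schmidt residual: \<open>a\<close> minus its orthogonal projection to the span of \<open>E'\<close>.\<close>
    define r where "r = a - (\<Sum>e\<in>E'. b a e *\<^sub>R e)"
    have proj: "(\<Sum>e\<in>E'. b a e *\<^sub>R e) \<in> span E'"
      by (intro span_sum span_scale span_base)
    then have "r \<noteq> 0" using False by (auto simp: r_def)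
    then have pos: "b r r > 0" by (rule inner_product_pos[OF ip])
    have orth: "b r e = 0" if "e \<in> E'" for e
    proof -
      have "b (\<Sum>f\<in>E'. b a f *\<^sub>R f) e = (\<Sum>f\<in>E'. if f = e then b a f else 0)"
        unfolding bilinear_sum_left[OF b] using E'(3) that
        by (intro sum.cong) (auto simp: bilinear_simps[OF b] orthonormal_set_def)
      then show ?thesis
        using that E'(1) by (simp add: r_def bilinear_simps[OF b])
    qed
    define f where "f = (1 / sqrt (b r r)) *\<^sub>R r"
    have "b f f = 1" "b f e = 0" "b e f = 0" if "e \<in> E'" for e
      using pos orth[OF that]
      by (auto simp: f_def bilinear_simps[OF b] inner_product_sym[OF ip, of e r])
    then have fE: "b f f = 1 \<and> (\<forall>e\<in>E'. b f e = 0 \<and> b e f = 0)"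
      using pos by (auto simp: f_def bilinear_simps[OF b])
    then have "f \<notin> E'" by force
    then have "orthonormal_set b (insert f E')"
      using E'(3) fE by (auto simp: orthonormal_set_def)
    moreover have "span (insert f E') = span (insert a E')"
    proof -
      have a: "a = r + (\<Sum>e\<in>E'. b a e *\<^sub>R e)" by (simp add: r_def)
      have "r \<in> span (insert a E')"
        unfolding r_def by (intro span_diff span_sum span_scale span_base) auto
      then have "f \<in> span (insert a E')"
        unfolding f_def by (rule span_scale)
      moreover have "r = sqrt (b r r) *\<^sub>R f"
        using pos by (simp add: f_def)
      then have "r \<in> span (insert f E')"
        by (metis insertI1 span_base span_scale)
      then have "a \<in> span (insert f E')"
        using proj span_mono[of E' "insert f E'"] by (subst a) (auto intro: span_add)
      ultimately show ?thesis
        by (intro span_eq[THEN iffD2]) (auto intro: span_base)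
    qed
    ultimately show ?thesis
      using E' span_insert by (intro exI[of _ "insert f E'"]) auto
  qed
qed

text \<open>
  The frame is a sequence rather than a set because the ordering of its members selects one of the two
  rotations in each coordinate plane, and makes membership of \<open>e i\<close> in the span of \<open>W\<close> a condition on \<open>i\<close>.
\<close>

lemma adapted_orthonormal_frame:
  fixes b :: "'a::real_vector \<Rightarrow> 'a \<Rightarrow> real"
  assumes ip: "inner_product b" and fin: "finite B" "span B = (UNIV :: 'a set)"
  obtains e :: "nat \<Rightarrow> 'a"
  where "\<And>i j. i < dim (UNIV :: 'a set) \<Longrightarrow> j < dim (UNIV :: 'a set) \<Longrightarrow>
      b (e i) (e j) = (if i = j then 1 else 0)"
    and "span (e ` {..<dim W}) = span W" and "span (e ` {..<dim (UNIV :: 'a set)}) = UNIV"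
proof -
  note b = inner_product_bilinear[OF ip]
  obtain C where C: "C \<subseteq> W" "independent C" "W \<subseteq> span C" "card C = dim W"
    by (rule basis_exists)
  have "finite C"
    using independent_span_bound[OF fin(1) C(2)] fin(2) by simp
  then obtain E where E: "finite E" "orthonormal_set b E" "span E = span C"
    using orthonormal_set_extend[OF ip, of "{}" C] by (auto simp: orthonormal_set_def)
  have spanE: "span E = span W"
    using E(3) C(1,3) by (metis span_eq span_superset subset_trans)
  obtain F where F: "finite F" "E \<subseteq> F" "orthonormal_set b F" "span F = UNIV"
  proof -
    have "span (E \<union> B) = UNIV" using span_mono[of B "E \<union> B"] fin(2) by blast
    then show ?thesis using orthonormal_set_extend[OF ip E(1,2) fin(1)] that by auto
  qed
  have cardE: "card E = dim W"
    using dim_eq_card[OF spanE orthonormal_set_independent[OF b E(2)]] by simp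
  have cardF: "card F = dim (UNIV :: 'a set)"
    using dim_eq_card[of F UNIV, OF _ orthonormal_set_independent[OF b F(3)]] F(4) by simp
  have le: "card E \<le> card F" using F(1,2) by (rule card_mono)
  obtain h where h: "bij_betw h {..<card E} E"
    using ex_bij_betw_nat_finite[OF E(1)] by (auto simp: lessThan_atLeast0)
  have "card {card E..<card F} = card (F - E)"
    using F(1,2) E(1) by (simp add: card_Diff_subset)
  then obtain k where k: "bij_betw k {card E..<card F} (F - E)"
    using F(1) by (meson bij_betw_iff_card finite_Diff finite_atLeastLessThan)
  define e where "e i = (if i < card E then h i else k i)" for i
  have e1: "bij_betw e {..<card E} E"
    using h by (rule bij_betw_cong[THEN iffD1, rotated]) (simp add: e_def)
  have "bij_betw e {card E..<card F} (F - E)"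
    using k by (rule bij_betw_cong[THEN iffD1, rotated]) (simp add: e_def)
  then have e2: "bij_betw e {..<card F} F"
    using bij_betw_combine[OF e1, of "{card E..<card F}" "F - E"] le F(2)
    by (simp add: Un_absorb1 ivl_disj_un)
  show ?thesis
  proof
    show "span (e ` {..<dim W}) = span W"
      using e1 spanE by (simp add: bij_betw_def cardE)
    show "span (e ` {..<dim (UNIV :: 'a set)}) = UNIV"
      using e2 F(4) by (simp add: bij_betw_def cardF)
    fix i j assume "i < dim (UNIV :: 'a set)" "j < dim (UNIV :: 'a set)"
    then show "b (e i) (e j) = (if i = j then 1 else 0)"
      using e2 F(3) unfolding cardF orthonormal_set_def
      by (auto simp: bij_betw_def inj_on_def)
  qed
qed

section \<open>Infinitesimal rigid motions\<close>

text \<open>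
  The inner product \<open>b\<close> is one of two: the invariant one of an arbitrary space, or the one that generates
  the norm of a Euclidean space. Positions are measured from the base point \<open>p a\<close>, and the span of the
  differences is the direction space of the affine hull of the placement.
\<close>

locale adapted_frame =
  fixes b :: "'a::real_normed_vector \<Rightarrow> 'a \<Rightarrow> real" and e :: "nat \<Rightarrow> 'a" and n d :: nat
    and S :: "'s set" and p :: "'s \<Rightarrow> 'a" and a :: 's
  assumes ip: "inner_product b" and bb: "bounded_bilinear b"
    and orthonormal: "\<And>i j. i < d \<Longrightarrow> j < d \<Longrightarrow> b (e i) (e j) = (if i = j then 1 else 0)"
    and frame_W: "span (e ` {..<n}) = span ((\<lambda>v. p v - p a) ` S)"
    and frame_UNIV: "span (e ` {..<d}) = UNIV"
    and n_le_d: "n \<le> d" and a: "a \<in> S"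
begin

abbreviation W :: "'a set" where "W \<equiv> span ((\<lambda>v. p v - p a) ` S)"

lemmas b_bilinear = inner_product_bilinear[OF ip]
lemmas b_simps = bilinear_simps[OF b_bilinear]
lemmas b_sym = inner_product_sym[OF ip]

lemma expansion:
  assumes "m \<le> d" "x \<in> span (e ` {..<m})"
  shows "(\<Sum>i<m. b x (e i) *\<^sub>R e i) = x"
proof -
  let ?f = "\<lambda>x. \<Sum>i<m. b x (e i) *\<^sub>R e i"
  have "linear ?f"
    by (intro linearI) (simp_all add: b_simps scaleR_add_left sum.distrib scaleR_sum_right)
  moreover have "?f y = id y" if y: "y \<in> e ` {..<m}" for y
  proof -
    obtain k where k: "k < m" "y = e k" using y by auto
    have "?f y = (\<Sum>i<m. if i = k then e i else 0)"
      using k assms(1) by (intro sum.cong) (auto simp: orthonormal)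
    then show ?thesis using k by simp
  qed
  ultimately have "?f x = id x"
    by (rule linear_eq_on_span[OF _ linear_id _ assms(2)])
  then show ?thesis by (simp only: id_apply)
qed

lemma frame_ext:
  assumes "\<And>l. l < d \<Longrightarrow> b x (e l) = b y (e l)"
  shows "x = y"
proof -
  have "x = (\<Sum>i<d. b x (e i) *\<^sub>R e i)"
    by (rule expansion[symmetric]) (simp_all add: frame_UNIV)
  also have "\<dots> = (\<Sum>i<d. b y (e i) *\<^sub>R e i)"
    by (intro sum.cong) (simp_all add: assms)
  also have "\<dots> = y"
    by (rule expansion) (simp_all add: frame_UNIV)
  finally show ?thesis .
qed

definition rotation_field :: "nat \<times> nat \<Rightarrow> 'a \<Rightarrow> 'a"
  where "rotation_field z x = b x (e (fst z)) *\<^sub>R e (snd z) - b x (e (snd z)) *\<^sub>R e (fst z)"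

lemma linear_rotation_field: "linear (rotation_field z)"
  unfolding rotation_field_def
  by (intro linear_compose_sub linearI) (simp_all add: b_simps scaleR_add_left)

text \<open>
  The pairs of frame vectors of which at least one is in \<open>W\<close>. A rotation in a plane orthogonal to \<open>W\<close> does
  not move the placement to first order.
\<close>

definition rotation_index :: "(nat \<times> nat) set"
  where "rotation_index = (SIGMA j:{..<n}. {j<..<d})"

lemma finite_rotation_index: "finite rotation_index"
  by (simp add: rotation_index_def)

lemma sum_rotation_field_coordinate:
  assumes "k < n" "l < d"
  shows "b (\<Sum>z\<in>rotation_index. c z *\<^sub>R rotation_field z (e k)) (e l) =
    (if k < l then c (k, l) else 0) - (if l < k then c (l, k) else 0)"
proof -
  have "b (\<Sum>z\<in>rotation_index. c z *\<^sub>R rotation_field z (e k)) (e l) =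
      (\<Sum>z\<in>rotation_index. (if z = (k, l) then c z else 0) - (if z = (l, k) then c z else 0))"
    unfolding bilinear_sum_left[OF b_bilinear]
  proof (intro sum.cong refl)
    fix z assume "z \<in> rotation_index"
    then have "fst z < d" "snd z < d" "fst z \<noteq> snd z"
      using n_le_d by (auto simp: rotation_index_def)
    then show "b (c z *\<^sub>R rotation_field z (e k)) (e l) =
        (if z = (k, l) then c z else 0) - (if z = (l, k) then c z else 0)"
      using assms n_le_d by (cases z) (auto simp: rotation_field_def b_simps orthonormal)
  qed
  also have "\<dots> = (if (k, l) \<in> rotation_index then c (k, l) else 0) -
      (if (l, k) \<in> rotation_index then c (l, k) else 0)"
    by (simp add: sum_subtractf finite_rotation_index)
  finally show ?thesis
    using assms n_le_d by (auto simp: rotation_index_def)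
qed

text \<open>
  On \<open>W\<close> a skew map is determined by its matrix entries \<open>(j, i)\<close> with \<open>j < n\<close> and \<open>j < i\<close>: those with \<open>i < j\<close>
  are the negatives of entries already listed, and the diagonal vanishes.
\<close>

lemma skew_map_eq_sum_rotation_fields:
  assumes L: "linear L" and skew: "\<And>x y. x \<in> W \<Longrightarrow> y \<in> W \<Longrightarrow> b (L x) y + b x (L y) = 0"
    and x: "x \<in> W"
  shows "L x = (\<Sum>z\<in>rotation_index. b (L (e (fst z))) (e (snd z)) *\<^sub>R rotation_field z x)"
proof -
  have lin: "linear (\<lambda>x. \<Sum>z\<in>rotation_index. b (L (e (fst z))) (e (snd z)) *\<^sub>R rotation_field z x)"
    by (intro linear_compose_sum linear_compose_scale_right linear_rotation_field ballI)
  have "L y = (\<Sum>z\<in>rotation_index. b (L (e (fst z))) (e (snd z)) *\<^sub>R rotation_field z y)"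
    if y: "y \<in> e ` {..<n}" for y
  proof -
    obtain k where k: "k < n" "y = e k" using y by auto
    show ?thesis
    proof (rule frame_ext)
      fix l assume l: "l < d"
      have eW: "e i \<in> W" if "i < n" for i
        using that frame_W span_base[of "e i" "e ` {..<n}"] by auto
      have skew': "b (L (e k)) (e l) = - b (L (e l)) (e k)" if "l < n"
        using skew[OF eW[OF k(1)] eW[OF that]] b_sym[of "e k" "L (e l)"] by simp
      have skew0: "b (L (e k)) (e k) = 0"
        using skew[OF eW[OF k(1)] eW[OF k(1)]] b_sym[of "e k" "L (e k)"] by simp
      show "b (L y) (e l) = b (\<Sum>z\<in>rotation_index. b (L (e (fst z))) (e (snd z)) *\<^sub>R rotation_field z y) (e l)"
      proof -
        note coord = sum_rotation_field_coordinate[OF k(1) l]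
        show ?thesis
        proof (cases l k rule: linorder_cases)
          case less
          then show ?thesis using skew' k by (simp add: coord)
        next
          case equal
          then show ?thesis using skew0 coord k(2) by simp
        next
          case greater
          then show ?thesis using k(2) by (simp add: coord)
        qed
      qed
    qed
  qed
  moreover have "x \<in> span (e ` {..<n})" using x by (simp only: frame_W)
  ultimately show ?thesis by (rule linear_eq_on_span[OF L lin])
qed

text \<open>
  These are the velocities of \<open>b\<close>-isometric motions of the placement. Skewness of \<open>L\<close> is required on \<open>W\<close>
  alone because the placement determines \<open>L\<close> only there.
\<close>

definition rigid_motions :: "('s \<Rightarrow> 'a) set"
  where "rigid_motions = {u \<in> families S. \<exists>L. linear L \<and>
    (\<forall>x\<in>W. \<forall>y\<in>W. b (L x) y + b x (L y) = 0) \<and> (\<forall>v\<in>S. u v = u a + L (p v - p a))}"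

definition basic_motion :: "nat + nat \<times> nat \<Rightarrow> 's \<Rightarrow> 'a"
  where "basic_motion k v = (if v \<in> S
    then (case k of Inl i \<Rightarrow> e i | Inr z \<Rightarrow> rotation_field z (p v - p a)) else 0)"

definition motion_index :: "(nat + nat \<times> nat) set"
  where "motion_index = {..<d} <+> rotation_index"

lemma finite_motion_index: "finite motion_index"
  by (simp add: motion_index_def finite_rotation_index)

lemma card_motion_index: "real (card motion_index) = (real n + 1) * (2 * real d - real n) / 2"
proof -
  have "m \<le> d \<Longrightarrow> 2 * real (\<Sum>j<m. d - Suc j) = real m * (2 * real d - real m - 1)" for m
  proof (induction m)
    case (Suc m)
    then have "2 * real (\<Sum>j<m. d - Suc j) = real m * (2 * real d - real m - 1)" by simp
    moreover have "real (d - Suc m) = real d - real m - 1"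
      using Suc.prems by (simp add: of_nat_diff)
    ultimately show ?case by (simp add: algebra_simps)
  qed simp
  from this[OF n_le_d] have "2 * real (card rotation_index) = real n * (2 * real d - real n - 1)"
    by (simp add: rotation_index_def)
  moreover have "card motion_index = d + card rotation_index"
    by (simp add: motion_index_def card_Plus finite_rotation_index)
  ultimately show ?thesis by (simp add: field_simps)
qed

lemma sum_basic_motion:
  assumes "v \<in> S"
  shows "(\<Sum>k\<in>motion_index. c k *\<^sub>R basic_motion k) v =
    (\<Sum>i<d. c (Inl i) *\<^sub>R e i) + (\<Sum>z\<in>rotation_index. c (Inr z) *\<^sub>R rotation_field z (p v - p a))"
proof -
  have "(\<Sum>k\<in>motion_index. c k *\<^sub>R basic_motion k) v = (\<Sum>k\<in>motion_index. c k *\<^sub>R basic_motion k v)"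
    by (simp only: sum_fun_apply scaleR_fun_apply)
  also have "\<dots> = (\<Sum>i<d. c (Inl i) *\<^sub>R basic_motion (Inl i) v) +
      (\<Sum>z\<in>rotation_index. c (Inr z) *\<^sub>R basic_motion (Inr z) v)"
    unfolding motion_index_def
    by (subst sum.Plus) (simp_all add: finite_rotation_index o_def)
  finally show ?thesis
    using assms by (simp add: basic_motion_def)
qed

lemma rigid_motions_subset: "rigid_motions \<subseteq> span (basic_motion ` motion_index)"
proof
  fix u assume "u \<in> rigid_motions"
  then obtain L where u: "u \<in> families S" and L: "linear L"
    "\<And>x y. x \<in> W \<Longrightarrow> y \<in> W \<Longrightarrow> b (L x) y + b x (L y) = 0" "\<And>v. v \<in> S \<Longrightarrow> u v = u a + L (p v - p a)"
    by (auto simp: rigid_motions_def)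
  define c where "c k = (case k of Inl i \<Rightarrow> b (u a) (e i) | Inr z \<Rightarrow> b (L (e (fst z))) (e (snd z)))" for k
  have "u v = (\<Sum>k\<in>motion_index. c k *\<^sub>R basic_motion k) v" for v
  proof (cases "v \<in> S")
    case True
    have "p v - p a \<in> W" using True by (intro span_base) auto
    then have "L (p v - p a) = (\<Sum>z\<in>rotation_index. c (Inr z) *\<^sub>R rotation_field z (p v - p a))"
      by (subst skew_map_eq_sum_rotation_fields[OF L(1,2)]) (simp_all add: c_def)
    moreover have "u a = (\<Sum>i<d. c (Inl i) *\<^sub>R e i)"
      using expansion[of d "u a"] by (simp add: c_def frame_UNIV)
    ultimately show ?thesis using L(3)[OF True] sum_basic_motion[OF True, of c] by simp
  next
    case False
    then show ?thesis using u by (simp add: families_def sum_fun_apply basic_motion_def)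
  qed
  then have u_eq: "u = (\<Sum>k\<in>motion_index. c k *\<^sub>R basic_motion k)" by (rule ext)
  show "u \<in> span (basic_motion ` motion_index)"
    by (subst u_eq) (intro span_sum span_scale span_base imageI)
qed

text \<open>
  At the base point only the translations contribute, so their coefficients vanish. What remains is a skew
  map that vanishes on \<open>W\<close>, and its matrix entries are the coefficients of the rotations.
\<close>

lemma basic_motions_independent:
  "inj_on basic_motion motion_index" "independent (basic_motion ` motion_index)"
proof -
  have *: "c j = 0" if c: "(\<Sum>k\<in>motion_index. c k *\<^sub>R basic_motion k) = 0" and j: "j \<in> motion_index" for c j
  proof -
    have zero: "(\<Sum>i<d. c (Inl i) *\<^sub>R e i) +
        (\<Sum>z\<in>rotation_index. c (Inr z) *\<^sub>R rotation_field z (p v - p a)) = 0" if "v \<in> S" for v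
      using sum_basic_motion[OF that, of c] c by simp
    have trans: "(\<Sum>i<d. c (Inl i) *\<^sub>R e i) = 0"
      using zero[OF a] linear_0[OF linear_rotation_field] by simp
    have rot: "(\<Sum>z\<in>rotation_index. c (Inr z) *\<^sub>R rotation_field z x) = 0" if "x \<in> W" for x
    proof -
      have "linear (\<lambda>x. \<Sum>z\<in>rotation_index. c (Inr z) *\<^sub>R rotation_field z x)"
        by (intro linear_compose_sum linear_compose_scale_right linear_rotation_field ballI)
      then show ?thesis
      proof (rule linear_eq_0_on_span[OF _ _ that])
        fix y assume "y \<in> (\<lambda>v. p v - p a) ` S"
        then obtain v where "v \<in> S" "y = p v - p a" by blast
        with zero[of v] trans show "(\<Sum>z\<in>rotation_index. c (Inr z) *\<^sub>R rotation_field z y) = 0"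
          by simp
      qed
    qed
    show ?thesis
    proof (cases j)
      case (Inl l)
      then have l: "l < d" using j by (auto simp: motion_index_def)
      have "0 = b (\<Sum>i<d. c (Inl i) *\<^sub>R e i) (e l)"
        using trans by (simp add: b_simps)
      also have "\<dots> = (\<Sum>i<d. if i = l then c (Inl i) else 0)"
        unfolding bilinear_sum_left[OF b_bilinear]
        using l by (intro sum.cong) (auto simp: b_simps orthonormal)
      finally show ?thesis using l Inl by simp
    next
      case (Inr z)
      then obtain k l where z: "z = (k, l)" "k < n" "k < l" "l < d"
        using j by (cases z) (auto simp: motion_index_def rotation_index_def)
      have "e k \<in> W" using z(2) frame_W span_base[of "e k" "e ` {..<n}"] by auto
      from rot[OF this] have "0 = b (\<Sum>z\<in>rotation_index. c (Inr z) *\<^sub>R rotation_field z (e k)) (e l)"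
        by (simp add: b_simps)
      also have "\<dots> = c (Inr (k, l))"
        using sum_rotation_field_coordinate[OF z(2,4), of "\<lambda>z. c (Inr z)"] z(3) by simp
      finally show ?thesis using Inr z by simp
    qed
  qed
  show "inj_on basic_motion motion_index"
    by (rule independent_familyI(1)[OF finite_motion_index]) (rule *)
  show "independent (basic_motion ` motion_index)"
    by (rule independent_familyI(2)[OF finite_motion_index]) (rule *)
qed

end

section \<open>Trivial motions are rigid\<close>

text \<open>
  The isometries realising a trivial finite motion are chosen separately for each time, so nothing is known
  about the continuity of \<open>A\<close> in \<open>t\<close> beyond its action on the differences \<open>p v - p a\<close>.
\<close>

lemma trivial_finite_motion_linear_parts:
  fixes p :: "'s \<Rightarrow> 'a::real_normed_vector"
  assumes motion: "trivial_finite_motion S p \<delta> \<alpha>" and a: "a \<in> S"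
  obtains A where "\<And>t. linear_isometry (A t)"
    "\<And>t v. \<bar>t\<bar> < \<delta> \<Longrightarrow> v \<in> S \<Longrightarrow> A t (p v - p a) = \<alpha> v t - \<alpha> a t"
proof -
  have "\<exists>A. linear_isometry A \<and> (\<bar>t\<bar> < \<delta> \<longrightarrow> (\<forall>v\<in>S. A (p v - p a) = \<alpha> v t - \<alpha> a t))" for t
  proof (cases "\<bar>t\<bar> < \<delta>")
    case True
    then have "t \<in> {-\<delta><..<\<delta>}" by auto
    then have "(\<lambda>v. \<alpha> v t) \<in> orbit S p"
      using motion unfolding trivial_finite_motion_def by blast
    then obtain g where g: "g \<in> isometries" "\<And>v. v \<in> S \<Longrightarrow> \<alpha> v t = g (p v)"
      by (auto simp: orbit_def)
    obtain A where A: "linear_isometry A" "\<And>x y. g x - g y = A (x - y)"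
      using isometry_linear_part[OF g(1)] by blast
    then show ?thesis using g(2) a by (intro exI[of _ A]) simp
  next
    case False
    \<comment> \<open>Outside the interval of definition the identity serves as a default value.\<close>
    then show ?thesis using linear_isometry_id by blast
  qed
  then show ?thesis using that by metis
qed

context adapted_frame
begin

lemma frame_in_W: "j < n \<Longrightarrow> e j \<in> W"
  unfolding frame_W[symmetric] by (rule span_base) simp

lemma expansion_W: "x \<in> W \<Longrightarrow> (\<Sum>j<n. b x (e j) *\<^sub>R e j) = x"
  by (rule expansion[OF n_le_d]) (simp only: frame_W)

text \<open>
  Although \<open>t \<mapsto> A t\<close> may be discontinuous, \<open>t \<mapsto> A t x\<close> is differentiable at \<open>0\<close> for all \<open>x\<close> in \<open>W\<close>, since this
  holds for the spanning vectors \<open>p v - p a\<close>. The derivative \<open>L\<close> is linear in \<open>x\<close>, and it is skew because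
  \<open>b (A t x) (A t y)\<close> is constant. Outside \<open>W\<close> it is extended by \<open>0\<close> on the orthogonal complement.
\<close>

lemma trivial_motions_rigid:
  assumes inv: "\<And>A x y. linear_isometry A \<Longrightarrow> b (A x) (A y) = b x y"
  shows "trivial_motions S p \<subseteq> rigid_motions"
proof
  fix u assume "u \<in> trivial_motions S p"
  then obtain \<delta> \<alpha> where u: "u \<in> families S"
    and motion: "trivial_finite_motion S p \<delta> \<alpha>"
    and deriv: "\<And>v. v \<in> S \<Longrightarrow> (\<alpha> v has_vector_derivative u v) (at 0)"
    by (auto simp: trivial_motions_def)
  have \<delta>: "\<delta> > 0" and start: "\<And>v. v \<in> S \<Longrightarrow> \<alpha> v 0 = p v"
    using motion by (auto simp: trivial_finite_motion_def)
  obtain A where A: "\<And>t. linear_isometry (A t)"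
    and A_p: "\<And>t v. \<bar>t\<bar> < \<delta> \<Longrightarrow> v \<in> S \<Longrightarrow> A t (p v - p a) = \<alpha> v t - \<alpha> a t"
    using trivial_finite_motion_linear_parts[OF motion a] by blast
  have lin: "linear (A t)" for t using A[of t] by (simp add: linear_isometry_def)
  have deriv_p: "((\<lambda>t. A t (p v - p a)) has_vector_derivative (u v - u a)) (at 0)"
    if v: "v \<in> S" for v
  proof (rule has_vector_derivative_transform_within_open[where S = "{-\<delta><..<\<delta>}"])
    show "((\<lambda>t. \<alpha> v t - \<alpha> a t) has_vector_derivative (u v - u a)) (at 0)"
      by (intro derivative_intros deriv v a)
  qed (use \<delta> v A_p in auto)
  have ex_deriv: "\<exists>y. ((\<lambda>t. A t x) has_vector_derivative y) (at 0)" if "x \<in> W" for x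
  proof -
    have "subspace {x. \<exists>y. ((\<lambda>t. A t x) has_vector_derivative y) (at 0)}"
    proof (intro subspaceI CollectI)
      have "((\<lambda>t. A t 0) has_vector_derivative 0) (at 0)"
        by (simp add: linear_0[OF lin])
      then show "\<exists>y. ((\<lambda>t. A t 0) has_vector_derivative y) (at 0)" ..
    next
      fix x y assume "x \<in> {x. \<exists>y. ((\<lambda>t. A t x) has_vector_derivative y) (at 0)}"
        "y \<in> {x. \<exists>y. ((\<lambda>t. A t x) has_vector_derivative y) (at 0)}"
      then obtain x' y' where "((\<lambda>t. A t x) has_vector_derivative x') (at 0)"
        "((\<lambda>t. A t y) has_vector_derivative y') (at 0)" by blast
      then have "((\<lambda>t. A t (x + y)) has_vector_derivative x' + y') (at 0)"
        unfolding linear_add[OF lin] by (rule has_vector_derivative_add)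
      then show "\<exists>z. ((\<lambda>t. A t (x + y)) has_vector_derivative z) (at 0)" ..
    next
      fix c :: real and x assume "x \<in> {x. \<exists>y. ((\<lambda>t. A t x) has_vector_derivative y) (at 0)}"
      then obtain x' where "((\<lambda>t. A t x) has_vector_derivative x') (at 0)" by blast
      then have "((\<lambda>t. A t (c *\<^sub>R x)) has_vector_derivative c *\<^sub>R x') (at 0)"
        unfolding linear_scale[OF lin]
        by (rule bounded_linear.has_vector_derivative[OF bounded_linear_scaleR_right])
      then show "\<exists>z. ((\<lambda>t. A t (c *\<^sub>R x)) has_vector_derivative z) (at 0)" ..
    qed
    moreover have "(\<lambda>v. p v - p a) ` S \<subseteq> {x. \<exists>y. ((\<lambda>t. A t x) has_vector_derivative y) (at 0)}"
      using deriv_p by blast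
    ultimately show ?thesis using span_minimal that by blast
  qed
  obtain D where D: "\<And>x. x \<in> W \<Longrightarrow> ((\<lambda>t. A t x) has_vector_derivative D x) (at 0)"
    using ex_deriv by metis
  define L where "L x = (\<Sum>j<n. b x (e j) *\<^sub>R D (e j))" for x
  have "linear L"
    unfolding L_def
    by (intro linearI) (simp_all add: b_simps scaleR_add_left sum.distrib scaleR_sum_right)
  have L_deriv: "((\<lambda>t. A t x) has_vector_derivative L x) (at 0)" if "x \<in> W" for x
  proof -
    have "A t x = (\<Sum>j<n. b x (e j) *\<^sub>R A t (e j))" for t
    proof -
      have "A t x = A t (\<Sum>j<n. b x (e j) *\<^sub>R e j)"
        by (simp only: expansion_W[OF that])
      also have "\<dots> = (\<Sum>j<n. b x (e j) *\<^sub>R A t (e j))"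
        by (simp add: linear_sum[OF lin] linear_scale[OF lin])
      finally show ?thesis .
    qed
    moreover have "((\<lambda>t. \<Sum>j<n. b x (e j) *\<^sub>R A t (e j)) has_vector_derivative L x) (at 0)"
      unfolding L_def
      by (intro has_vector_derivative_sum D frame_in_W
          bounded_linear.has_vector_derivative[OF bounded_linear_scaleR_right]) simp
    ultimately show ?thesis by (simp only:)
  qed
  have A0: "A 0 x = x" if "x \<in> W" for x
  proof -
    have "A 0 x = id x"
    proof (rule linear_eq_on_span[OF lin linear_id _ that])
      fix y assume "y \<in> (\<lambda>v. p v - p a) ` S"
      then obtain v where "v \<in> S" "y = p v - p a" by blast
      then show "A 0 y = id y" using A_p[of 0 v] \<delta> start a by simp
    qed
    then show ?thesis by simp
  qed
  have "b (L x) y + b x (L y) = 0" if x: "x \<in> W" and y: "y \<in> W" for x y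
  proof -
    have "((\<lambda>t. b (A t x) (A t y)) has_vector_derivative b (A 0 x) (L y) + b (L x) (A 0 y)) (at 0)"
      by (rule bounded_bilinear.has_vector_derivative[OF bb L_deriv[OF x] L_deriv[OF y]])
    moreover have "((\<lambda>t. b (A t x) (A t y)) has_vector_derivative 0) (at 0)"
      by (simp add: inv[OF A])
    ultimately have "b (A 0 x) (L y) + b (L x) (A 0 y) = 0"
      by (rule vector_derivative_unique_at)
    then show ?thesis by (simp add: A0 x y)
  qed
  moreover have "u v = u a + L (p v - p a)" if v: "v \<in> S" for v
  proof -
    have "p v - p a \<in> W" using v by (intro span_base) blast
    from vector_derivative_unique_at[OF deriv_p[OF v] L_deriv[OF this]]
    show ?thesis by (simp add: algebra_simps)
  qed
  ultimately show "u \<in> rigid_motions"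
    using u \<open>linear L\<close> unfolding rigid_motions_def by blast
qed

section \<open>Every rigid motion of a Euclidean space is trivial\<close>

text \<open>
  The finite motions behind the basic motions are the translations along \<open>e i\<close> and the rotations about \<open>p a\<close>
  in the plane of \<open>e j\<close> and \<open>e i\<close>.
\<close>

lemma euclidean_basic_motion_trivial:
  assumes norm_b: "\<And>x. norm x = sqrt (b x x)" and p: "p \<in> families S"
    and k: "k \<in> motion_index"
  shows "basic_motion k \<in> trivial_motions S p"
proof (cases k)
  case (Inl i)
  define \<alpha> where "\<alpha> v t = (if v \<in> S then p v + t *\<^sub>R e i else 0)" for v t
  have iso: "(\<lambda>x. x + t *\<^sub>R e i) \<in> isometries" for t
  proof -
    have "bij (\<lambda>x. x + t *\<^sub>R e i)"
      by (rule o_bij[of "\<lambda>x. x - t *\<^sub>R e i"]) (auto simp: fun_eq_iff)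
    then show ?thesis by (simp add: isometries_def)
  qed
  have "trivial_finite_motion S p 1 \<alpha>"
    using iso
    by (auto simp: trivial_finite_motion_def orbit_def families_def \<alpha>_def[abs_def] intro!: continuous_intros)
  moreover have "(\<alpha> v has_vector_derivative basic_motion k v) (at 0)" if "v \<in> S" for v
    using that unfolding \<alpha>_def[abs_def] by (auto simp: basic_motion_def Inl intro!: derivative_eq_intros)
  moreover have "basic_motion k \<in> families S"
    by (simp add: families_def basic_motion_def)
  ultimately show ?thesis unfolding trivial_motions_def by blast
next
  case (Inr z)
  obtain j i where z: "z = (j, i)" by fastforce
  have ji: "j < d" "i < d" "j \<noteq> i"
    using k n_le_d by (auto simp: Inr z motion_index_def rotation_index_def)
  have on: "b (e j) (e j) = 1" "b (e i) (e i) = 1" "b (e j) (e i) = 0" "b (e i) (e j) = 0"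
    using ji by (simp_all add: orthonormal)
  define R where "R t x = x + (cos t - 1) *\<^sub>R (b x (e j) *\<^sub>R e j + b x (e i) *\<^sub>R e i) +
    sin t *\<^sub>R rotation_field z x" for t x
  have R': "R t x = x + ((cos t - 1) * b x (e j) - sin t * b x (e i)) *\<^sub>R e j +
      ((cos t - 1) * b x (e i) + sin t * b x (e j)) *\<^sub>R e i" for t x
    by (simp add: R_def rotation_field_def z algebra_simps)
  have lin: "linear (R t)" for t
    unfolding R_def
    by (intro linear_compose_add linear_compose_scale_right linear_rotation_field linear_ident linearI)
       (simp_all add: b_simps scaleR_add_left)
  have R_coord: "b (R t x) (e j) = cos t * b x (e j) - sin t * b x (e i)"
    "b (R t x) (e i) = cos t * b x (e i) + sin t * b x (e j)" for t x
    by (simp_all add: R' b_simps on algebra_simps)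
  have norm_R: "norm (R t x) = norm x" for t x
  proof -
    have alg: "b x x + ((c - 1) * X - s * Y) * X + ((c - 1) * Y + s * X) * Y +
        ((c - 1) * X - s * Y) * (c * X - s * Y) + ((c - 1) * Y + s * X) * (c * Y + s * X) =
        b x x + (s\<^sup>2 + c\<^sup>2 - 1) * (X\<^sup>2 + Y\<^sup>2)" for c s X Y
      by (simp add: algebra_simps power2_eq_square)
    have "b (R t x) (R t x) = b (R t x) x + ((cos t - 1) * b x (e j) - sin t * b x (e i)) * b (R t x) (e j) +
      ((cos t - 1) * b x (e i) + sin t * b x (e j)) * b (R t x) (e i)"
      by (subst (2) R') (simp add: b_simps)
    also have "b (R t x) x = b x x + ((cos t - 1) * b x (e j) - sin t * b x (e i)) * b x (e j) +
      ((cos t - 1) * b x (e i) + sin t * b x (e j)) * b x (e i)"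
      by (simp add: R' b_simps b_sym[of "e j" x] b_sym[of "e i" x])
    finally have "b (R t x) (R t x) = b x x"
      unfolding R_coord alg by simp
    then show ?thesis by (simp add: norm_b)
  qed
  have R_inv: "R (- t) (R t x) = x" for t x
  proof -
    have alg: "((c - 1) * X - s * Y) + ((c - 1) * (c * X - s * Y) + s * (c * Y + s * X)) =
        (s\<^sup>2 + c\<^sup>2 - 1) * X" for c X s Y :: real
      by (simp add: algebra_simps power2_eq_square)
    have "R (- t) (R t x) = R t x + ((cos t - 1) * b (R t x) (e j) + sin t * b (R t x) (e i)) *\<^sub>R e j +
      ((cos t - 1) * b (R t x) (e i) - sin t * b (R t x) (e j)) *\<^sub>R e i"
      by (subst R') simp
    also have "\<dots> = x + (((cos t - 1) * b x (e j) - sin t * b x (e i)) +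
        ((cos t - 1) * b (R t x) (e j) + sin t * b (R t x) (e i))) *\<^sub>R e j +
      (((cos t - 1) * b x (e i) + sin t * b x (e j)) +
        ((cos t - 1) * b (R t x) (e i) - sin t * b (R t x) (e j))) *\<^sub>R e i"
      by (subst R') (simp only: scaleR_add_left add.assoc add.commute add.left_commute)
    also have "((cos t - 1) * b x (e j) - sin t * b x (e i)) +
        ((cos t - 1) * b (R t x) (e j) + sin t * b (R t x) (e i)) = 0"
      unfolding R_coord using alg[of "cos t" "b x (e j)" "sin t" "b x (e i)"] by simp
    also have "((cos t - 1) * b x (e i) + sin t * b x (e j)) +
        ((cos t - 1) * b (R t x) (e i) - sin t * b (R t x) (e j)) = 0"
      unfolding R_coord using alg[of "cos t" "b x (e i)" "- sin t" "b x (e j)"] by simp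
    finally show ?thesis by simp
  qed
  \<comment> \<open>The rotation by the angle \<open>t\<close> about \<open>p a\<close>.\<close>
  define \<alpha> where "\<alpha> v t = (if v \<in> S then p a + R t (p v - p a) else 0)" for v t
  have iso: "(\<lambda>x. p a + R t (x - p a)) \<in> isometries" for t
  proof -
    have "bij (\<lambda>x. p a + R t (x - p a))"
      using R_inv[of t] R_inv[of "- t"]
      by (intro o_bij[of "\<lambda>x. p a + R (- t) (x - p a)"]) (auto simp: fun_eq_iff)
    moreover have "R t (x - p a) - R t (y - p a) = R t (x - y)" for x y
      using linear_diff[OF lin[of t], of "x - p a" "y - p a"] by simp
    ultimately show ?thesis by (simp add: isometries_def dist_norm norm_R)
  qed
  have "trivial_finite_motion S p 1 \<alpha>"
    using iso
    by (auto simp: trivial_finite_motion_def orbit_def families_def \<alpha>_def[abs_def] R_def[abs_def]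
        intro!: continuous_intros)
  moreover have "(\<alpha> v has_vector_derivative basic_motion k v) (at 0)" if "v \<in> S" for v
    using that unfolding \<alpha>_def[abs_def] R_def
    by (auto simp: basic_motion_def Inr intro!: derivative_eq_intros)
  moreover have "basic_motion k \<in> families S"
    by (simp add: families_def basic_motion_def)
  ultimately show ?thesis unfolding trivial_motions_def by blast
qed

section \<open>Spaces with all rigid motions are Euclidean\<close>

text \<open>
  Let \<open>m\<close> maximise \<open>b m w\<close> over the compact set \<open>Z\<close> of vectors with the norm and the \<open>b\<close>-length of \<open>z\<close>. Along a
  trivial motion \<open>w\<close> becomes \<open>A t w\<close>, and \<open>b m (A t w) = b ((A t)\<^sup>-\<^sup>1 m) w\<close> is at most \<open>b m w\<close> because
  \<open>(A t)\<^sup>-\<^sup>1 m\<close> is again in \<open>Z\<close>. So the derivative of this function vanishes at \<open>0\<close>. That condition is linear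
  in the motion, therefore it holds for every rigid motion, in particular for the infinitesimal rotation from \<open>w\<close>
  towards \<open>m\<close>. Hence equality holds in the Cauchy-Schwarz inequality for \<open>m\<close> and \<open>w\<close>. As \<open>Z = - Z\<close>, the maximum
  is nonnegative, which leaves \<open>m = w\<close>.
\<close>

lemma norm_constant_on_spheres:
  assumes inv: "\<And>A x y. linear_isometry A \<Longrightarrow> b (A x) (A y) = b x y"
    and compact: "\<And>K :: 'a set. closed K \<Longrightarrow> bounded K \<Longrightarrow> compact K"
    and full: "rigid_motions \<subseteq> span (trivial_motions S p)"
    and v: "v \<in> S" and w: "w = p v - p a" and z: "b z z = b w w"
  shows "norm z = norm w"
proof -
  define Z where "Z = {x. norm x = norm z \<and> b x x = b z z}"
  have cont: "continuous_on UNIV (\<lambda>x. b x x)" "continuous_on K (\<lambda>x. b x w)" for K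
    by (intro bounded_bilinear.continuous_on[OF bb] continuous_intros)+
  have "closed Z"
    unfolding Z_def by (intro closed_Collect_conj closed_Collect_eq continuous_intros cont)
  moreover have "bounded Z"
    unfolding bounded_iff Z_def by auto
  ultimately have "compact Z" by (rule compact)
  moreover have "z \<in> Z" by (simp add: Z_def)
  ultimately have "\<exists>m\<in>Z. \<forall>x\<in>Z. b x w \<le> b m w"
    by (intro continuous_attains_sup cont) auto
  then obtain m where m: "m \<in> Z" and max: "\<And>x. x \<in> Z \<Longrightarrow> b x w \<le> b m w" by blast
  have crit: "b m (u v - u a) = 0" if u: "u \<in> trivial_motions S p" for u
  proof -
    obtain \<delta> \<alpha> where motion: "trivial_finite_motion S p \<delta> \<alpha>"
      and deriv: "\<And>v. v \<in> S \<Longrightarrow> (\<alpha> v has_vector_derivative u v) (at 0)"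
      using u by (auto simp: trivial_motions_def)
    have \<delta>: "\<delta> > 0" and start: "\<And>v. v \<in> S \<Longrightarrow> \<alpha> v 0 = p v"
      using motion by (auto simp: trivial_finite_motion_def)
    obtain A where A: "\<And>t. linear_isometry (A t)"
      and A_p: "\<And>t v. \<bar>t\<bar> < \<delta> \<Longrightarrow> v \<in> S \<Longrightarrow> A t (p v - p a) = \<alpha> v t - \<alpha> a t"
      using trivial_finite_motion_linear_parts[OF motion a] by blast
    have "((\<lambda>t. b m (\<alpha> v t - \<alpha> a t)) has_vector_derivative b m (u v - u a)) (at 0)"
      by (intro bounded_linear.has_vector_derivative[OF bounded_bilinear.bounded_linear_right[OF bb]]
          derivative_intros deriv v a)
    then have "DERIV (\<lambda>t. b m (\<alpha> v t - \<alpha> a t)) 0 :> b m (u v - u a)"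
      by (simp add: has_real_derivative_iff_has_vector_derivative)
    moreover have "b m (\<alpha> v t - \<alpha> a t) \<le> b m (\<alpha> v 0 - \<alpha> a 0)" if t: "\<bar>0 - t\<bar> < \<delta>" for t
    proof -
      let ?A' = "inv (A t)"
      have A': "linear_isometry ?A'" by (rule linear_isometry_inv[OF A])
      have "?A' m \<in> Z"
        using m inv[OF A'] A' by (simp add: Z_def linear_isometry_def)
      then have "b (?A' m) w \<le> b m w" by (rule max)
      moreover have "A t (?A' m) = m"
        using A[of t] by (simp add: linear_isometry_def bij_is_surj surj_f_inv_f)
      then have "b (?A' m) w = b m (A t w)"
        using inv[OF A, of t "?A' m" w] by simp
      ultimately show ?thesis
        using A_p[of t v] t v start a by (simp add: w)
    qed
    ultimately show ?thesis
      using DERIV_local_max[OF _ \<delta>] by blast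
  qed
  have "subspace {u. b m (u v - u a) = 0}"
    by (intro subspaceI) (auto simp: b_simps algebra_simps)
  then have crit_rigid: "b m (u v - u a) = 0" if "u \<in> rigid_motions" for u
    using span_minimal[of "trivial_motions S p" "{u. b m (u v - u a) = 0}"] crit full that by blast
  \<comment> \<open>The infinitesimal rotation in the plane of \<open>w\<close> and \<open>m\<close>, which sends \<open>w\<close> to \<open>b w w\<close> times the component of
    \<open>m\<close> orthogonal to \<open>w\<close>.\<close>
  define L where "L x = b x w *\<^sub>R m - b x m *\<^sub>R w" for x
  have L: "linear L"
    unfolding L_def by (intro linearI) (simp_all add: b_simps algebra_simps)
  define u where "u x = (if x \<in> S then L (p x - p a) else 0)" for x
  have "u \<in> rigid_motions"
    unfolding rigid_motions_def
  proof (intro CollectI conjI exI[of _ L] L)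
    show "u \<in> families S" by (simp add: u_def families_def)
    show "\<forall>x\<in>W. \<forall>y\<in>W. b (L x) y + b x (L y) = 0"
      by (simp add: L_def b_simps b_sym[of m] b_sym[of w])
    show "\<forall>v\<in>S. u v = u a + L (p v - p a)"
      using a linear_0[OF L] by (simp add: u_def)
  qed
  then have "b m (u v - u a) = 0" by (rule crit_rigid)
  then have "b w w * b m m = (b m w)\<^sup>2"
    using v a linear_0[OF L]
    by (simp add: u_def w[symmetric] L_def b_simps b_sym[of w m] power2_eq_square)
  then have "(b m w)\<^sup>2 = (b w w)\<^sup>2"
    using m z by (simp add: Z_def power2_eq_square)
  \<comment> \<open>The competitor \<open>- m\<close> lies in \<open>Z\<close> as well.\<close>
  moreover have "b m w \<ge> 0"
    using max[of "- m"] m by (simp add: Z_def b_simps)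
  moreover have "b w w \<ge> 0" by (rule inner_product_nonneg[OF ip])
  ultimately have "b m w = b w w" by (simp add: power2_eq_iff_nonneg)
  then have "b (m - w) (m - w) = 0"
    using m z by (simp add: Z_def b_simps b_sym[of w m])
  then have "m = w"
    using inner_product_pos[OF ip, of "m - w"] by force
  then show ?thesis using m by (simp add: Z_def)
qed

end

text \<open>
  The sphere through \<open>w\<close> fixes the ratio of the two norms in every direction.
\<close>

lemma euclidean_norm_if_constant_on_sphere:
  fixes b :: "'a::real_normed_vector \<Rightarrow> 'a \<Rightarrow> real"
  assumes ip: "inner_product b" and w: "w \<noteq> 0"
    and const: "\<And>z. b z z = b w w \<Longrightarrow> norm z = norm w"
  shows "euclidean_norm TYPE('a)"
proof -
  note b_simps = bilinear_simps[OF inner_product_bilinear[OF ip]]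
  define c where "c = (norm w)\<^sup>2 / b w w"
  have bw: "b w w > 0" using ip w by (rule inner_product_pos)
  then have c: "c > 0" using w by (simp add: c_def)
  have "inner_product (\<lambda>x y. c * b x y)"
    using ip c unfolding inner_product_def
    by (auto simp: bilinear_def intro!: linear_compose_scale_right[where 'b = real, unfolded real_scaleR_def])
  moreover have "norm x = sqrt (c * b x x)" for x
  proof (cases "x = 0")
    case True
    then show ?thesis by (simp add: b_simps)
  next
    case False
    then have bx: "b x x > 0" by (rule inner_product_pos[OF ip])
    define s where "s = sqrt (b w w / b x x)"
    have s: "s > 0" "s\<^sup>2 = b w w / b x x" using bw bx by (auto simp: s_def)
    have "b (s *\<^sub>R x) (s *\<^sub>R x) = s\<^sup>2 * b x x" by (simp add: b_simps power2_eq_square)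
    then have "norm (s *\<^sub>R x) = norm w"
      using s bx by (intro const) simp
    then have "norm w = s * norm x" using s by simp
    then have "c * b x x = (norm x)\<^sup>2"
      using s bw bx by (simp add: c_def power_mult_distrib)
    then show ?thesis by simp
  qed
  ultimately show ?thesis unfolding euclidean_norm_def by blast
qed

section \<open>The dimension of the space of trivial motions\<close>

theorem proposition5p6:
  fixes S :: "'s set" and p :: "'s \<Rightarrow> 'a::real_normed_vector" and d n :: nat
  assumes "\<exists>B :: 'a set. finite B \<and> span B = UNIV"
    and "dim (UNIV :: 'a set) = d"
    and "p \<in> families S"
    and "affine_dimension (affine hull (p ` S)) = n"
    and "1 \<le> n" and "n \<le> d"
  shows "real (dim (trivial_motions S p)) \<le> (real n + 1) * (2 * real d - real n) / 2 \<and>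
    (real (dim (trivial_motions S p)) = (real n + 1) * (2 * real d - real n) / 2 \<longleftrightarrow>
      euclidean_norm TYPE('a))"
proof -
  let ?N = "(real n + 1) * (2 * real d - real n) / 2"
  obtain B0 :: "'a set" where B0: "finite B0" "span B0 = UNIV" using assms(1) by blast
  obtain B :: "'a set" where B: "independent B" "UNIV \<subseteq> span B" by (rule basis_exists)
  then have B: "independent B" "finite B" "span B = UNIV"
    using independent_span_bound[OF B0(1), of B] B0(2) by auto
  have "S \<noteq> {}"
    using assms(4,5) dim_le_card[of "{}" "{} :: 'a set"] by (auto simp: affine_dimension_def)
  then obtain a where a: "a \<in> S" by blast
  let ?D = "(\<lambda>v. p v - p a) ` S"
  have dimD: "dim ?D = n"
  proof -
    have "span ?D = span {x - y |x y. x \<in> affine hull (p ` S) \<and> y \<in> affine hull (p ` S)}"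
      using span_differences_affine_hull[of "p a" "p ` S"] a by (simp add: image_image)
    from arg_cong[where f = dim, OF this]
    have "dim ?D = dim {x - y |x y. x \<in> affine hull (p ` S) \<and> y \<in> affine hull (p ` S)}"
      by (simp only: dim_span)
    then show ?thesis using assms(4) by (simp add: affine_dimension_def)
  qed
  have frame: "\<exists>e. adapted_frame b e n d S p a" if b: "inner_product b" "bounded_bilinear b"
    for b :: "'a \<Rightarrow> 'a \<Rightarrow> real"
  proof -
    obtain e where e: "\<And>i j. i < d \<Longrightarrow> j < d \<Longrightarrow> b (e i) (e j) = (if i = j then 1 else 0)"
      "span (e ` {..<n}) = span ?D" "span (e ` {..<d}) = UNIV"
      by (rule adapted_orthonormal_frame[OF b(1) B0, of ?D, unfolded assms(2) dimD]) (rule that)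
    have "adapted_frame b e n d S p a"
      by (rule adapted_frame.intro) (fact b e assms(6) a)+
    then show ?thesis by (rule exI[of _ e])
  qed
  obtain b :: "'a \<Rightarrow> 'a \<Rightarrow> real" where b: "inner_product b" "bounded_bilinear b"
    and inv: "\<And>A x y. linear_isometry A \<Longrightarrow> b (A x) (A y) = b x y"
    using invariant_inner_product_exists[OF B] by blast
  obtain e where "adapted_frame b e n d S p a" using frame[OF b] by blast
  then interpret adapted_frame b e n d S p a .
  let ?M = "basic_motion ` motion_index"
  have finM: "finite ?M" using finite_motion_index by (rule finite_imageI)
  have cardM: "card ?M = card motion_index"
    using basic_motions_independent(1) by (rule card_image)
  have T: "trivial_motions S p \<subseteq> span ?M"
  proof (rule subset_trans[OF _ rigid_motions_subset])
    show "trivial_motions S p \<subseteq> rigid_motions"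
      by (rule trivial_motions_rigid) (rule inv)
  qed
  have "dim (trivial_motions S p) \<le> card motion_index"
    using dim_le_card[OF T finM] by (simp add: cardM)
  then have bound: "real (dim (trivial_motions S p)) \<le> ?N"
    by (simp only: card_motion_index[symmetric] of_nat_le_iff)
  have "euclidean_norm TYPE('a)" if "real (dim (trivial_motions S p)) = ?N"
  proof -
    have dimT: "dim (trivial_motions S p) = card ?M"
      using that by (simp only: card_motion_index[symmetric] of_nat_eq_iff cardM)
    obtain C where C: "C \<subseteq> trivial_motions S p" "independent C" "card C = card ?M"
      by (rule basis_exists[of "trivial_motions S p", unfolded dimT]) (rule that)
    have "span ?M \<subseteq> span C"
      by (rule span_subset_span_if_card_le[OF finM C(2) subset_trans[OF C(1) T]]) (simp only: C(3))
    then have "span ?M \<subseteq> span (trivial_motions S p)"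
      using span_mono[OF C(1)] by (rule subset_trans)
    with rigid_motions_subset have full: "rigid_motions \<subseteq> span (trivial_motions S p)"
      by (rule subset_trans)
    \<comment> \<open>Here \<open>n \<ge> 1\<close> is essential: a single point spans no direction to compare with.\<close>
    have "\<exists>v\<in>S. p v - p a \<noteq> 0"
    proof (rule ccontr)
      assume "\<not> ?thesis"
      then have "?D \<subseteq> {0}" by auto
      then have "dim ?D \<le> card ({} :: 'a set)" by (intro dim_le_card) auto
      then show False using dimD assms(5) by simp
    qed
    then obtain v where v: "v \<in> S" "p v - p a \<noteq> 0" by blast
    show ?thesis
    proof (rule euclidean_norm_if_constant_on_sphere[OF ip v(2)])
      fix z assume z: "b z z = b (p v - p a) (p v - p a)"
      show "norm z = norm (p v - p a)"
        by (rule norm_constant_on_spheres[OF _ _ full v(1) refl z])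
           (rule inv compact_if_closed_bounded[OF B]; assumption)+
    qed
  qed
  moreover have "real (dim (trivial_motions S p)) = ?N" if euclidean: "euclidean_norm TYPE('a)"
  proof -
    obtain c :: "'a \<Rightarrow> 'a \<Rightarrow> real" where c: "inner_product c" "\<And>x. norm x = sqrt (c x x)"
      using euclidean unfolding euclidean_norm_def by blast
    have "c x x \<le> 1 * (norm x)\<^sup>2" for x
      using inner_product_nonneg[OF c(1), of x] by (simp add: c(2))
    then have "bounded_bilinear c"
      by (rule inner_product_bounded(1)[OF c(1)])
    then obtain f where "adapted_frame c f n d S p a" using frame[OF c(1)] by blast
    then interpret E: adapted_frame c f n d S p a .
    have "trivial_motions S p \<subseteq> E.rigid_motions"
      by (rule E.trivial_motions_rigid) (rule euclidean_inner_product_invariant[OF c])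
    then have "trivial_motions S p \<subseteq> span (E.basic_motion ` E.motion_index)"
      using E.rigid_motions_subset by (rule subset_trans)
    moreover have "E.basic_motion ` E.motion_index \<subseteq> trivial_motions S p"
      by (intro image_subsetI E.euclidean_basic_motion_trivial[OF c(2) assms(3)])
    ultimately have "dim (trivial_motions S p) = card (E.basic_motion ` E.motion_index)"
      using E.basic_motions_independent(2) by (intro dim_unique[OF _ _ _ refl])
    also have "\<dots> = card E.motion_index"
      using E.basic_motions_independent(1) by (rule card_image)
    finally show ?thesis by (simp only: E.card_motion_index)
  qed
  ultimately show ?thesis using bound by (intro conjI iffI)
qed

end
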